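(* Let $\Delta$ be a simplicial complex on $[n-1]$, let $F\in\mathscr{C}_{n-1,k}(\Delta)$ and $R\in\mathscr{C}_{n-1,k-1}(\Delta)$, and set $T=F\cup\operatorname{Cone}(n,R)$. Then $\tilde H_*(T)\cong H_*(F,R)$, and $T\in\mathscr{T}_{n,k}(\operatorname{Cone}(n,\Delta))$ if and only if $(F,R)\in\mathscr{F}^{\mathrm{root}}_{n-1,k}(\Delta)$. Moreover, the map $\varphi(X):=(\operatorname{Proj}(n,X),\operatorname{Link}(n,X))$ restricts to a bijection $\mathscr{T}_{n,k}(\operatorname{Cone}(n,\Delta))\to\mathscr{F}^{\mathrm{root}}_{n-1,k}(\Delta)$.
   Context: For $m\ge1$, a $j$-face on $[m]$ is a subset of size $j+1$; a simplicial complex on $[m]$ is a nonempty family of subsets of $[m]$ closed under taking subsets (complexes on $[n-1]$ are regarded as complexes on $[n]$). $X_j$ is the set of $j$-faces of $X$ ($X_{-1}=\{\emptyset\}$), $K_m^k$ the family of all subsets of $[m]$ of size at most $k+1$. Faces are oriented by the increasing order; $\partial$ denotes the oriented boundary matrix, with rows indexed by $(j-1)$-faces and columns by $j$-faces, entry $(-1)^i$ if $\sigma=\tau\setminus\{\tau_i\}$ ($\tau=\{\tau_0<\dots<\tau_j\}$) and $0$ otherwise; $M_{A,B}$ is the submatrix with rows $A$, columns $B$. Reduced homology $\tilde H_j(X)$ is the homology of $(\mathbb{Z}^{X_j},\partial_{X_{j-1},X_j})_{j\ge -1}$; for complexes $Y\subseteq X$, the relative homology $H_j(X,Y)$ is the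 homology of $(\mathbb{Z}^{X_j\setminus Y_j},\partial_{X_{j-1}\setminus Y_{j-1},X_j\setminus Y_j})_j$; $\beta_j$ denotes the rank of the free part. For a complex $\Delta$ on $[m]$, $\mathscr{C}_{m,k}(\Delta):=\{X: K_m^{k-1}\cap\Delta\subseteq X\subseteq K_m^k\cap\Delta\}$; $\mathscr{T}_{m,k}(\Delta)$ is the set of $X\in\mathscr{C}_{m,k}(\Delta)$ with $\beta_k(X)=0$ and $|X_k|=\operatorname{rank}\partial_{\Delta_{k-1},\Delta_k}$; $\mathscr{F}^{\mathrm{root}}_{m,k}(\Delta)$ is the set of pairs $(X,Y)\in\mathscr{C}_{m,k}(\Delta)\times\mathscr{C}_{m,k-1}(\Delta)$ (so $Y\subseteq X$) satisfying at least two of: $|X_k|=|X_{k-1}\setminus Y_{k-1}|$, $\beta_{k-1}(X,Y)=0$, $\beta_k(X,Y)=0$. For $\Delta$ on $[n-1]$: $\operatorname{Cone}(n,\Delta)=\Delta\cup\{\sigma\cup\{n\}:\sigma\in\Delta\}$, and for $X\in\mathscr{C}_{n,k}(\operatorname{Cone}(n,\Delta))$, $\operatorname{Proj}(n,X)=X\cap\Delta$ and $\operatorname{Link}(n,X)=\{\sigma\in\Delta:\sigma\cup\{n\}\in X\}$. *)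

theory Defs
  imports
    Complex_Main
    "HOL-Algebra.Product_Groups"
    "HOL-Algebra.Coset"
    "HOL-Library.Function_Algebras"
begin

text \<open>Dimensions are integers, so that the face \<open>{}\<close> of dimension \<open>-1\<close> needs no special treatment;
  there are no faces of dimension below \<open>-1\<close>.\<close>

definition simplicial_complex_on :: "nat \<Rightarrow> nat set set \<Rightarrow> bool" where
  "simplicial_complex_on m X \<longleftrightarrow>
     X \<noteq> {} \<and> X \<subseteq> Pow {1..m} \<and> (\<forall>\<tau>\<in>X. \<forall>\<sigma>. \<sigma> \<subseteq> \<tau> \<longrightarrow> \<sigma> \<in> X)"

definition faces :: "nat set set \<Rightarrow> int \<Rightarrow> nat set set" where
  "faces X j = {\<sigma> \<in> X. finite \<sigma> \<and> int (card \<sigma>) = j + 1}"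

definition skel :: "nat \<Rightarrow> int \<Rightarrow> nat set set" where
  "skel m k = {\<sigma>. \<sigma> \<subseteq> {1..m} \<and> int (card \<sigma>) \<le> k + 1}"


section \<open>Boundary matrices\<close>

text \<open>At most one summand is nonzero, since the faces \<open>\<tau> - {\<tau>\<^sub>i}\<close> are pairwise distinct.\<close>

definition bdry :: "nat set \<Rightarrow> nat set \<Rightarrow> int" where
  "bdry \<sigma> \<tau> = (\<Sum>i<card \<tau>. if \<sigma> = \<tau> - {sorted_list_of_set \<tau> ! i} then (-1) ^ i else 0)"

text \<open>The rank of the submatrix \<open>M\<^sub>A\<^sub>,\<^sub>B\<close> of an integer matrix: the dimension over the rationals of the
  span of its columns.  A column is a function of the row index, extended by \<open>0\<close> outside \<open>A\<close>.\<close>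

definition submatrix_rank :: "('r \<Rightarrow> 'c \<Rightarrow> int) \<Rightarrow> 'r set \<Rightarrow> 'c set \<Rightarrow> nat" where
  "submatrix_rank M A B =
     vector_space.dim (\<lambda>(q::rat) v. (\<lambda>\<sigma>. q * v \<sigma>))
       ((\<lambda>\<tau> \<sigma>. if \<sigma> \<in> A then rat_of_int (M \<sigma> \<tau>) else 0) ` B)"


section \<open>Homology\<close>

text \<open>The group \<open>\<int>\<^sup>S\<close>, and the map \<open>\<int>\<^sup>B \<rightarrow> \<int>\<^sup>A\<close> given by the submatrix \<open>M\<^sub>A\<^sub>,\<^sub>B\<close>.\<close>

definition int_vectors :: "'a set \<Rightarrow> ('a \<Rightarrow> int) monoid" where
  "int_vectors S = product_group S (\<lambda>_. integer_group)"

definition submatrix_map :: "('r \<Rightarrow> 'c \<Rightarrow> int) \<Rightarrow> 'r set \<Rightarrow> 'c set \<Rightarrow> ('c \<Rightarrow> int) \<Rightarrow> ('r \<Rightarrow> int)" where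
  "submatrix_map M A B c = (\<lambda>\<sigma>\<in>A. \<Sum>\<tau>\<in>B. M \<sigma> \<tau> * c \<tau>)"

text \<open>Homology in degree \<open>j\<close> of the complex with chain groups \<open>\<int>\<^bsup>C i\<^esup>\<close> and the corresponding
  submatrices of the boundary matrix as differentials.\<close>

definition cell_homology :: "(int \<Rightarrow> nat set set) \<Rightarrow> int \<Rightarrow> (nat set \<Rightarrow> int) set monoid" where
  "cell_homology C j =
     (int_vectors (C j))
       \<lparr>carrier := kernel (int_vectors (C j)) (int_vectors (C (j - 1)))
                     (submatrix_map bdry (C (j - 1)) (C j))\<rparr>
     Mod (submatrix_map bdry (C j) (C (j + 1)) ` carrier (int_vectors (C (j + 1))))"

definition reduced_homology :: "nat set set \<Rightarrow> int \<Rightarrow> (nat set \<Rightarrow> int) set monoid" where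
  "reduced_homology X = cell_homology (faces X)"

definition relative_homology ::
    "nat set set \<Rightarrow> nat set set \<Rightarrow> int \<Rightarrow> (nat set \<Rightarrow> int) set monoid" where
  "relative_homology X Y = cell_homology (\<lambda>j. faces X j - faces Y j)"

definition torsion :: "('a, 'b) monoid_scheme \<Rightarrow> 'a set" where
  "torsion G = {x \<in> carrier G. \<exists>m::nat. m > 0 \<and> x [^]\<^bsub>G\<^esub> m = \<one>\<^bsub>G\<^esub>}"

text \<open>The rank of the free part \<open>G / torsion G\<close> of a finitely generated abelian group \<open>G\<close>.\<close>

definition free_rank :: "('a, 'b) monoid_scheme \<Rightarrow> nat" where
  "free_rank G = (THE r. (G Mod torsion G) \<cong> int_vectors {..<r})"

definition betti :: "nat set set \<Rightarrow> int \<Rightarrow> nat" where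
  "betti X j = free_rank (reduced_homology X j)"

definition relative_betti :: "nat set set \<Rightarrow> nat set set \<Rightarrow> int \<Rightarrow> nat" where
  "relative_betti X Y j = free_rank (relative_homology X Y j)"


section \<open>Spanning trees and rooted forests\<close>

text \<open>For \<open>k \<ge> 0\<close> and a complex \<open>\<Delta>\<close> the members of \<open>complexes_between m k \<Delta>\<close> are automatically
  simplicial complexes.  For \<open>k = -1\<close> the lower bound is empty, so the members are \<open>{{}}\<close> and the
  void family \<open>{}\<close>.  The latter has to be admitted as the root part of a rooted forest of
  dimension \<open>0\<close>: it is the link of \<open>n\<close> in a \<open>0\<close>-dimensional tree that does not contain \<open>n\<close>.\<close>

definition complexes_between :: "nat \<Rightarrow> int \<Rightarrow> nat set set \<Rightarrow> nat set set set" where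
  "complexes_between m k \<Delta> = {X. skel m (k - 1) \<inter> \<Delta> \<subseteq> X \<and> X \<subseteq> skel m k \<inter> \<Delta>}"

definition spanning_trees :: "nat \<Rightarrow> int \<Rightarrow> nat set set \<Rightarrow> nat set set set" where
  "spanning_trees m k \<Delta> =
     {X \<in> complexes_between m k \<Delta>.
        betti X k = 0 \<and>
        card (faces X k) = submatrix_rank bdry (faces \<Delta> (k - 1)) (faces \<Delta> k)}"

definition rooted_forests ::
    "nat \<Rightarrow> int \<Rightarrow> nat set set \<Rightarrow> (nat set set \<times> nat set set) set" where
  "rooted_forests m k \<Delta> =
     {(X, Y). X \<in> complexes_between m k \<Delta> \<and> Y \<in> complexes_between m (k - 1) \<Delta> \<and>
        (let P = (card (faces X k) = card (faces X (k - 1) - faces Y (k - 1)));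
             Q = (relative_betti X Y (k - 1) = 0);
             S = (relative_betti X Y k = 0)
         in (P \<and> Q) \<or> (P \<and> S) \<or> (Q \<and> S))}"


section \<open>Cone, projection and link\<close>

definition Cone :: "nat \<Rightarrow> nat set set \<Rightarrow> nat set set" where
  "Cone n \<Delta> = \<Delta> \<union> {\<sigma> \<union> {n} | \<sigma>. \<sigma> \<in> \<Delta>}"

text \<open>Projection and link depend on the base \<open>\<Delta>\<close> of the ambient cone, which is made explicit.\<close>

definition Proj :: "nat set set \<Rightarrow> nat set set \<Rightarrow> nat set set" where
  "Proj \<Delta> X = X \<inter> \<Delta>"

definition Link :: "nat \<Rightarrow> nat set set \<Rightarrow> nat set set \<Rightarrow> nat set set" where
  "Link n \<Delta> X = {\<sigma> \<in> \<Delta>. \<sigma> \<union> {n} \<in> X}"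

end

theory Submission
  imports Defs "HOL-Algebra.Free_Abelian_Groups"
begin

text \<open>Restriction of chains maps the chain complex of \<open>T = F \<union> Cone n R\<close> onto the relative complex of
  \<open>(F, R)\<close>, with kernel the chain complex of the cone over \<open>R\<close>, which is acyclic; hence the isomorphism
  in homology.  The relative complex lives in the degrees \<open>k\<close> and \<open>k - 1\<close> only, so it is a single
  integer matrix \<open>M\<close>, and the three conditions defining a rooted forest say that \<open>M\<close> is square, that its
  cokernel is torsion and that it is injective; over the rationals any two of these imply the third.
  The cone over \<open>\<Delta>\<close> is acyclic as well, and its \<open>k\<close>-th boundary matrix has rank
  \<open>card (faces \<Delta> (k - 1))\<close>, so \<open>T\<close> is a spanning tree iff \<open>M\<close> is square and injective.\<close>

section \<open>Rank of finitely generated abelian groups\<close>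

text \<open>\<open>free_rank\<close> is a definite description, so a Betti number says nothing until
  the torsion quotient of a finitely generated abelian group is known to be free of a unique rank.
  The group theory serves to turn \<open>free_rank (cell_homology C j) = 0\<close> into an
  elementary condition: every cycle has a positive multiple that is a boundary. After that only
  integer matrices remain, and clearing denominators moves between the integers and the rationals.
  The apex \<open>n\<close> exceeds every vertex of the base, so it comes last in each oriented
  face. Inserting it leaves the other signs alone, and deleting it costs (-1) to the number of
  remaining vertices; every sign in the cone arguments comes from this. The homological part works
  with families of faces indexed by degree instead of complexes, because the faces of F outside R
  form no simplicial complex. This covers the void R that occurs for k = 0: its cone is void too,
  and the relative complex is the whole reduced complex of F.\<close>

lemma carrier_int_vectors [simp]: "carrier (int_vectors S) = (S \<rightarrow>\<^sub>E UNIV)"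
  by (simp add: int_vectors_def)

lemma mult_int_vectors [simp]: "x \<otimes>\<^bsub>int_vectors S\<^esub> y = (\<lambda>i\<in>S. x i + y i)"
  by (simp add: int_vectors_def)

lemma one_int_vectors [simp]: "\<one>\<^bsub>int_vectors S\<^esub> = (\<lambda>i\<in>S. 0)"
  by (simp add: int_vectors_def)

lemma comm_group_int_vectors [simp]: "comm_group (int_vectors S)"
proof (rule group.group_comm_groupI)
  show "group (int_vectors S)"
    by (simp add: int_vectors_def)
qed (auto intro: restrict_ext)

lemma group_int_vectors [simp]: "group (int_vectors S)"
  by (simp add: comm_group.axioms)

lemma pow_int_vectors: "x \<in> carrier (int_vectors S) \<Longrightarrow> x [^]\<^bsub>int_vectors S\<^esub> (m::nat) = (\<lambda>i\<in>S. int m * x i)"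
proof (induction m)
  case (Suc m)
  then show ?case
    by (auto simp: algebra_simps intro!: restrict_ext)
qed simp

text \<open>Over a finite index set the product of copies of the integers is also the direct sum, so
  invariance of rank for free abelian groups transfers. It yields uniqueness in the description of
  \<open>free_rank\<close>.\<close>

lemma int_vectors_iso_imp_card_eq:
  assumes "finite A" "finite B" "int_vectors A \<cong> int_vectors B"
  shows "card A = card B"
proof -
  have *: "int_vectors S \<cong> free_Abelian_group S" if "finite S" for S :: "'z set"
  proof -
    have "sum_group S (\<lambda>_. integer_group) = int_vectors S"
      using that by (intro monoid.equality) (auto simp: carrier_sum_group int_vectors_def)
    then show ?thesis
      using isomorphic_sum_integer_group[of S] by simp
  qed
  have "free_Abelian_group A \<cong> free_Abelian_group B"
    using *[OF assms(1)] *[OF assms(2)] assms(3) by (meson group.iso_sym group_int_vectors iso_trans)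
  then show ?thesis
    using isomorphic_free_Abelian_groups eqpoll_iff_card assms by blast
qed

section \<open>Freeness of finitely generated torsion-free abelian groups\<close>

lemma comm_group_subgroup:
  assumes "comm_group G" "subgroup H G"
  shows "comm_group (G\<lparr>carrier := H\<rparr>)"
proof -
  interpret comm_group G by fact
  interpret subgroup H G by fact
  show ?thesis
    using subgroup_imp_group[OF assms(2)] by (rule group.group_comm_groupI) (simp add: m_comm)
qed

text \<open>\<open>G\<close> is the internal direct product of \<open>H\<close> and an infinite
  cyclic group: \<open>dec\<close> says that \<open>H\<close> and \<open>g\<close> generate,
  \<open>ind\<close> that no nontrivial power of \<open>g\<close> falls into \<open>H\<close>. The
  new coordinate, with index \<open>r\<close>, is the exponent of \<open>g\<close>.\<close>

lemma int_vectors_iso_Suc: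
  fixes G (structure)
  assumes "comm_group G" "subgroup H G" "G\<lparr>carrier := H\<rparr> \<cong> int_vectors {..<r}" "g \<in> carrier G"
    and dec: "\<And>x. x \<in> carrier G \<Longrightarrow> \<exists>h\<in>H. \<exists>z::int. x = h \<otimes> g [^] z"
    and ind: "\<And>z::int. g [^] z \<in> H \<Longrightarrow> z = 0"
  shows "G \<cong> int_vectors {..<Suc r}"
proof -
  interpret comm_group G by fact
  interpret H: subgroup H G by fact
  interpret GH: group "G\<lparr>carrier := H\<rparr>" using assms(2) subgroup_imp_group by auto
  obtain \<phi> where \<phi>: "\<phi> \<in> iso (int_vectors {..<r}) (G\<lparr>carrier := H\<rparr>)"
    using GH.iso_sym[OF assms(3)] by (auto simp: is_iso_def)
  then have \<phi>hom: "\<phi> \<in> hom (int_vectors {..<r}) (G\<lparr>carrier := H\<rparr>)"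
    and \<phi>onto: "\<phi> ` carrier (int_vectors {..<r}) = H"
    and \<phi>inj: "inj_on \<phi> (carrier (int_vectors {..<r}))"
    by (auto simp: iso_def bij_betw_def)
  interpret \<phi>: group_hom "int_vectors {..<r}" "G\<lparr>carrier := H\<rparr>" \<phi>
    using \<phi>hom by (simp add: group_hom_def group_hom_axioms_def GH.is_group)
  have \<phi>H: "\<phi> c \<in> H" if "c \<in> {..<r} \<rightarrow>\<^sub>E UNIV" for c
    using that \<phi>onto by auto
  define \<psi> where "\<psi> c = \<phi> (restrict c {..<r}) \<otimes> g [^] (c r :: int)" for c
  have gz: "g [^] (z::int) \<in> carrier G" for z using assms(4) by simp
  have \<psi>hom: "\<psi> \<in> hom (int_vectors {..<Suc r}) G"
  proof (rule homI)
    fix c assume "c \<in> carrier (int_vectors {..<Suc r})"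
    show "\<psi> c \<in> carrier G"
      unfolding \<psi>_def using \<phi>H[of "restrict c {..<r}"] gz by auto
  next
    fix c d assume "c \<in> carrier (int_vectors {..<Suc r})" "d \<in> carrier (int_vectors {..<Suc r})"
    have "restrict (c \<otimes>\<^bsub>int_vectors {..<Suc r}\<^esub> d) {..<r}
       = restrict c {..<r} \<otimes>\<^bsub>int_vectors {..<r}\<^esub> restrict d {..<r}"
      by (auto simp: restrict_def)
    then have "\<phi> (restrict (c \<otimes>\<^bsub>int_vectors {..<Suc r}\<^esub> d) {..<r})
       = \<phi> (restrict c {..<r}) \<otimes> \<phi> (restrict d {..<r})"
      using \<phi>.hom_mult[of "restrict c {..<r}" "restrict d {..<r}"] by simp
    then show "\<psi> (c \<otimes>\<^bsub>int_vectors {..<Suc r}\<^esub> d) = \<psi> c \<otimes> \<psi> d"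
      using gz \<phi>H[of "restrict c {..<r}"] \<phi>H[of "restrict d {..<r}"] assms(4)
      by (simp add: \<psi>_def int_pow_mult m_ac)
  qed
  interpret \<psi>: group_hom "int_vectors {..<Suc r}" G \<psi>
    using \<psi>hom by (simp add: group_hom_def group_hom_axioms_def is_group)
  have "\<psi> \<in> iso (int_vectors {..<Suc r}) G"
    unfolding \<psi>.iso_iff
  proof (intro conjI ballI impI subsetI)
    fix x assume "x \<in> carrier G"
    then obtain h z where hz: "h \<in> H" "x = h \<otimes> g [^] (z::int)" using dec by blast
    then obtain c where c: "c \<in> {..<r} \<rightarrow>\<^sub>E UNIV" "h = \<phi> c" using \<phi>onto by auto
    have "restrict (c(r := z)) {..<r} = c" using c(1) by (auto simp: PiE_def extensional_def restrict_def)
    then have "x = \<psi> (c(r := z))" using hz c by (simp add: \<psi>_def)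
    moreover have "c(r := z) \<in> carrier (int_vectors {..<Suc r})"
      using c(1) by (auto simp: PiE_def extensional_def)
    ultimately show "x \<in> \<psi> ` carrier (int_vectors {..<Suc r})" by blast
  next
    fix c assume c: "c \<in> carrier (int_vectors {..<Suc r})" and 1: "\<psi> c = \<one>"
    let ?h = "\<phi> (restrict c {..<r})"
    have h: "?h \<in> H" by (rule \<phi>H) auto
    \<comment> \<open>A power of \<open>g\<close> that is the inverse of an element of
      \<open>H\<close> lies in \<open>H\<close>, so \<open>ind\<close> forces the exponent to
      vanish.\<close>
    then have "g [^] (c r) = inv ?h"
      using 1 gz unfolding \<psi>_def by (metis H.mem_carrier inv_equality inv_inv inv_closed)
    with h have "c r = 0" using ind by auto
    with 1 h have "?h = \<one>" by (simp add: \<psi>_def)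
    then have "restrict c {..<r} = \<one>\<^bsub>int_vectors {..<r}\<^esub>"
      using inj_onD[OF \<phi>inj, of "restrict c {..<r}" "\<one>\<^bsub>int_vectors {..<r}\<^esub>"] \<phi>.hom_one by simp
    then have "c i = 0" if "i < r" for i
      using that by (auto dest: fun_cong[of _ _ i])
    with \<open>c r = 0\<close> have c0: "c i = 0" if "i < Suc r" for i
      using that less_Suc_eq by auto
    show "c = \<one>\<^bsub>int_vectors {..<Suc r}\<^esub>"
    proof (rule ext)
      show "c i = \<one>\<^bsub>int_vectors {..<Suc r}\<^esub> i" for i
        using c0 c by (cases "i < Suc r") (auto simp: PiE_def extensional_def)
    qed
  qed
  then show ?thesis using \<psi>.G.iso_sym unfolding is_iso_def by blast
qed

text \<open>Commutativity lets all powers of \<open>g\<close> in a word be collected at its right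
  end.\<close>

lemma generate_insert_decomp:
  fixes G (structure)
  assumes "comm_group G" "S \<subseteq> carrier G" "g \<in> carrier G" "x \<in> generate G (insert g S)"
  shows "\<exists>h\<in>generate G S. \<exists>z::int. x = h \<otimes> g [^] z"
proof -
  interpret comm_group G by fact
  have sub: "subgroup (generate G S) G" using assms(2) by (rule generate_is_subgroup)
  interpret H: subgroup "generate G S" G by fact
  note [simp] = assms(3)
  show ?thesis using assms(4)
  proof induction
    case one
    show ?case by (rule bexI[of _ \<one>], rule exI[of _ 0]) auto
  next
    case (incl y)
    show ?case
    proof (cases "y = g")
      case True
      then show ?thesis by (intro bexI[of _ \<one>] exI[of _ "1::int"]) (auto simp: int_pow_1)
    next
      case False
      then show ?thesis using incl assms(2)
        by (intro bexI[of _ y] exI[of _ "0::int"]) (auto intro: generate.incl)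
    qed
  next
    case (inv y)
    show ?case
    proof (cases "y = g")
      case True
      then show ?thesis by (intro bexI[of _ \<one>] exI[of _ "-1::int"]) (auto simp: int_pow_neg int_pow_1)
    next
      case False
      then show ?thesis using inv assms(2)
        by (intro bexI[of _ "inv y"] exI[of _ "0::int"]) (auto intro: generate.inv)
    qed
  next
    case (eng a b)
    then obtain h z h' z' where "h \<in> generate G S" "h' \<in> generate G S" "a = h \<otimes> g [^] (z::int)" "b = h' \<otimes> g [^] (z'::int)"
      by blast
    then show ?case
      by (intro bexI[of _ "h \<otimes> h'"] exI[of _ "z + z'"]) (auto simp: int_pow_mult m_ac)
  qed
qed

definition fin_gen :: "('a, 'b) monoid_scheme \<Rightarrow> bool" where
  "fin_gen G \<longleftrightarrow> (\<exists>S. finite S \<and> S \<subseteq> carrier G \<and> carrier G = generate G S)"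

lemma trivial_iso_int_vectors:
  fixes G (structure)
  assumes "group G" "carrier G = {\<one>}"
  shows "G \<cong> int_vectors {..<0::nat}"
proof -
  interpret group G by fact
  have "(\<lambda>_. \<lambda>_. undefined) \<in> iso G (int_vectors {..<0::nat})"
    using assms by (auto simp: iso_def hom_def bij_betw_def inj_on_def restrict_def)
  then show ?thesis unfolding is_iso_def by blast
qed

text \<open>Division with remainder: the remainder is itself a value of \<open>f\<close>,
  nonnegative and below the least positive value, hence 0.\<close>

lemma hom_minimal_value_divides:
  fixes f :: "'a \<Rightarrow> int"
  assumes "comm_group K" "f \<in> hom K integer_group" "x0 \<in> carrier K" "f x0 > 0"
    and min: "\<And>y. y \<in> carrier K \<Longrightarrow> f y > 0 \<Longrightarrow> f x0 \<le> f y"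
    and "x \<in> carrier K"
  shows "f (x \<otimes>\<^bsub>K\<^esub> x0 [^]\<^bsub>K\<^esub> (- (f x div f x0))) = 0"
proof -
  interpret comm_group K by fact
  interpret f: group_hom K integer_group f
    using assms(2) by (simp add: group_hom_def group_hom_axioms_def is_group)
  have pw: "f (x0 [^]\<^bsub>K\<^esub> (z::int)) = z * f x0" for z
    using f.hom_int_pow[OF assms(3), of z] by (simp add: )
  let ?y = "x \<otimes>\<^bsub>K\<^esub> x0 [^]\<^bsub>K\<^esub> (- (f x div f x0))"
  have y: "?y \<in> carrier K" using assms by simp
  have fy: "f ?y = f x mod f x0"
    using assms f.hom_mult[of x "x0 [^]\<^bsub>K\<^esub> (- (f x div f x0))"] pw by (simp add: minus_div_mult_eq_mod [symmetric])
  have "f x mod f x0 < f x0" "f x mod f x0 \<ge> 0" using assms(4) by auto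
  moreover have "\<not> 0 < f ?y"
    using min[OF y] fy calculation(1) by linarith
  ultimately show ?thesis using fy by linarith
qed

text \<open>In substance, subgroups of a free abelian group of finite rank are free and finitely
  generated. The kernel of the last homomorphism is separated by the others, and if the image is
  nonzero it is infinite cyclic and splits off. Freeness serves torsion-free groups, finite
  generation serves the groups of cycles.\<close>

lemma separated_by_int_homs_imp_free:
  fixes K :: "('a, 'b) monoid_scheme" and f :: "nat \<Rightarrow> 'a \<Rightarrow> int"
  assumes "comm_group K" "\<And>i. i < m \<Longrightarrow> f i \<in> hom K integer_group"
    and "\<And>x. x \<in> carrier K \<Longrightarrow> (\<And>i. i < m \<Longrightarrow> f i x = 0) \<Longrightarrow> x = \<one>\<^bsub>K\<^esub>"
  shows "fin_gen K \<and> (\<exists>r. K \<cong> int_vectors {..<r::nat})"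
  using assms
proof (induction m arbitrary: K)
  case 0
  interpret comm_group K by fact
  have "carrier K = {\<one>\<^bsub>K\<^esub>}" using 0(3) by auto
  moreover have "carrier K = generate K {}" using calculation by (simp add: generate_empty)
  ultimately show ?case
    unfolding fin_gen_def by (metis empty_subsetI finite.emptyI is_group trivial_iso_int_vectors)
next
  case (Suc m)
  interpret comm_group K by fact
  interpret f: group_hom K integer_group "f m"
    using Suc.prems(2)[of m] by (simp add: group_hom_def group_hom_axioms_def is_group)
  define H where "H = kernel K integer_group (f m)"
  have H: "subgroup H K" unfolding H_def by (rule f.subgroup_kernel)
  interpret H: subgroup H K by fact
  have Hiff: "x \<in> H \<longleftrightarrow> x \<in> carrier K \<and> f m x = 0" for x
    unfolding H_def kernel_def by simp
  have IH: "fin_gen (K\<lparr>carrier := H\<rparr>) \<and> (\<exists>r. K\<lparr>carrier := H\<rparr> \<cong> int_vectors {..<r::nat})"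
  proof (rule Suc.IH)
    show "comm_group (K\<lparr>carrier := H\<rparr>)" by (rule comm_group_subgroup) fact+
    show "f i \<in> hom (K\<lparr>carrier := H\<rparr>) integer_group" if "i < m" for i
      using Suc.prems(2)[of i] that by (auto simp: hom_def)
    show "x = \<one>\<^bsub>K\<lparr>carrier := H\<rparr>\<^esub>" if "x \<in> carrier (K\<lparr>carrier := H\<rparr>)" "\<And>i. i < m \<Longrightarrow> f i x = 0" for x
      using Suc.prems(3)[of x] that Hiff by (auto simp: less_Suc_eq)
  qed
  show ?case
  proof (cases "\<exists>x\<in>carrier K. f m x \<noteq> 0")
    case False
    then have "H = carrier K" using Hiff by auto
    then have "K\<lparr>carrier := H\<rparr> = K" by simp
    with IH show ?thesis by simp
  next
    case True
    then obtain x where x: "x \<in> carrier K" "f m x \<noteq> 0" by blast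
    have "\<exists>y\<in>carrier K. f m y > 0"
    proof (cases "f m x > 0")
      case False
      then have "f m (inv\<^bsub>K\<^esub> x) > 0" using x f.hom_inv[of x] by simp
      then show ?thesis using x by blast
    qed (use x in blast)
    \<comment> \<open>\<open>x0\<close> maps to the least positive value of \<open>f m\<close>, the
      generator of its image; its powers form the complement of the kernel.\<close>
    then obtain x0 where x0: "x0 \<in> carrier K" "f m x0 > 0"
      and min: "\<And>y. y \<in> carrier K \<Longrightarrow> f m y > 0 \<Longrightarrow> f m x0 \<le> f m y"
      using ex_has_least_nat[of "\<lambda>y. y \<in> carrier K \<and> f m y > 0" _ "\<lambda>y. nat (f m y)"] by fastforce
    have dec: "\<exists>h\<in>H. \<exists>z::int. x = h \<otimes>\<^bsub>K\<^esub> x0 [^]\<^bsub>K\<^esub> z" if "x \<in> carrier K" for x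
    proof -
      let ?q = "f m x div f m x0"
      let ?y = "x \<otimes>\<^bsub>K\<^esub> x0 [^]\<^bsub>K\<^esub> (- ?q)"
      have "?y \<in> H"
        using hom_minimal_value_divides[of K "f m", OF \<open>comm_group K\<close> _ x0 min that] Suc.prems(2)[of m] that x0 Hiff by simp
      moreover have "x = ?y \<otimes>\<^bsub>K\<^esub> x0 [^]\<^bsub>K\<^esub> ?q"
        using that x0 by (simp add: m_assoc int_pow_mult[symmetric])
      ultimately show ?thesis by blast
    qed
    have ind: "z = 0" if "x0 [^]\<^bsub>K\<^esub> (z::int) \<in> H" for z
      using that x0 f.hom_int_pow[OF x0(1), of z] by (simp add: Hiff )
    obtain S where S: "finite S" "S \<subseteq> H" "H = generate (K\<lparr>carrier := H\<rparr>) S"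
      using IH by (auto simp: fin_gen_def)
    have HS: "H = generate K S" using S generate_consistent[OF S(2) H] by simp
    have SK: "insert x0 S \<subseteq> carrier K" using S(2) x0 by auto
    interpret g: subgroup "generate K (insert x0 S)" K by (rule generate_is_subgroup[OF SK])
    have "carrier K \<subseteq> generate K (insert x0 S)"
    proof
      fix x assume "x \<in> carrier K"
      then obtain h z where "h \<in> H" "x = h \<otimes>\<^bsub>K\<^esub> x0 [^]\<^bsub>K\<^esub> (z::int)" using dec by blast
      moreover have "h \<in> generate K (insert x0 S)"
        using \<open>h \<in> H\<close> HS mono_generate[of S "insert x0 S"] by auto
      moreover have "x0 [^]\<^bsub>K\<^esub> z \<in> generate K (insert x0 S)"
        by (rule subgroup_int_pow_closed[OF g.subgroup_axioms]) (simp add: generate.incl)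
      ultimately show "x \<in> generate K (insert x0 S)" by simp
    qed
    then have "fin_gen K" unfolding fin_gen_def using S(1) SK g.subset
      by (intro exI[of _ "insert x0 S"]) auto
    moreover obtain r where "K\<lparr>carrier := H\<rparr> \<cong> int_vectors {..<r::nat}" using IH by blast
    ultimately show ?thesis
      using int_vectors_iso_Suc[OF \<open>comm_group K\<close> H _ x0(1) dec ind] by blast
  qed
qed


text \<open>Induction on the generators: \<open>H\<close>, generated by all but \<open>g\<close>, is
  free. Either no positive power of \<open>g\<close> meets \<open>H\<close>, and \<open>g\<close>
  contributes a new free factor, or \<open>G\<close> has bounded exponent modulo \<open>H\<close>
  and is itself embedded in the free group \<open>H\<close>.\<close>

lemma torsion_free_fin_gen_imp_free:
  fixes G :: "('a, 'b) monoid_scheme"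
  assumes "finite S" "comm_group G" "S \<subseteq> carrier G" "carrier G = generate G S"
    and "\<And>x m. x \<in> carrier G \<Longrightarrow> (m::nat) > 0 \<Longrightarrow> x [^]\<^bsub>G\<^esub> m = \<one>\<^bsub>G\<^esub> \<Longrightarrow> x = \<one>\<^bsub>G\<^esub>"
  shows "\<exists>r. G \<cong> int_vectors {..<r::nat}"
  using assms
proof (induction S arbitrary: G)
  case empty
  interpret comm_group G by fact
  have "carrier G = {\<one>\<^bsub>G\<^esub>}" using empty(3) by (simp add: generate_empty)
  then show ?case using trivial_iso_int_vectors is_group by blast
next
  case (insert g S)
  interpret comm_group G by fact
  have g: "g \<in> carrier G" and S: "S \<subseteq> carrier G" using insert.prems by auto
  define H where "H = generate G S"
  have H: "subgroup H G" unfolding H_def by (rule generate_is_subgroup[OF S])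
  interpret H: subgroup H G by fact
  have SH: "S \<subseteq> H" unfolding H_def using generate.incl by auto
  have cH: "comm_group (G\<lparr>carrier := H\<rparr>)" by (rule comm_group_subgroup) fact+
  interpret GH: comm_group "G\<lparr>carrier := H\<rparr>" by fact
  have pw: "x [^]\<^bsub>G\<lparr>carrier := H\<rparr>\<^esub> (m::nat) = x [^]\<^bsub>G\<^esub> m" for x m
    by (rule nat_pow_consistent[symmetric])
  have "\<exists>r. G\<lparr>carrier := H\<rparr> \<cong> int_vectors {..<r::nat}"
  proof (rule insert.IH[OF cH])
    show "carrier (G\<lparr>carrier := H\<rparr>) = generate (G\<lparr>carrier := H\<rparr>) S"
      using generate_consistent[OF SH H] by (simp add: H_def)
    show "x = \<one>\<^bsub>G\<lparr>carrier := H\<rparr>\<^esub>"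
      if "x \<in> carrier (G\<lparr>carrier := H\<rparr>)" "0 < m" "x [^]\<^bsub>G\<lparr>carrier := H\<rparr>\<^esub> m = \<one>\<^bsub>G\<lparr>carrier := H\<rparr>\<^esub>" for x and m :: nat
      using insert.prems(4)[of x m] that pw by simp
  qed (use SH in auto)
  then obtain r where r: "G\<lparr>carrier := H\<rparr> \<cong> int_vectors {..<r::nat}" by blast
  have dec: "\<exists>h\<in>H. \<exists>z::int. x = h \<otimes>\<^bsub>G\<^esub> g [^]\<^bsub>G\<^esub> z" if "x \<in> carrier G" for x
    using generate_insert_decomp[OF \<open>comm_group G\<close> S g] insert.prems(3) that unfolding H_def by auto
  show ?case
  proof (cases "\<exists>N>0::nat. g [^]\<^bsub>G\<^esub> N \<in> H")
    case False
    have "z = 0" if z: "g [^]\<^bsub>G\<^esub> (z::int) \<in> H" for z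
    proof (rule ccontr)
      assume "z \<noteq> 0"
      then have "g [^]\<^bsub>G\<^esub> int (nat \<bar>z\<bar>) \<in> H"
      proof (cases "z > 0")
        case False
        then have "g [^]\<^bsub>G\<^esub> int (nat \<bar>z\<bar>) = inv\<^bsub>G\<^esub> (g [^]\<^bsub>G\<^esub> z)"
          using int_pow_neg[OF g, of z] by simp
        then show ?thesis using z by simp
      qed (use z in simp)
      then show False using False \<open>z \<noteq> 0\<close> by (metis int_pow_int zero_less_abs_iff zero_less_nat_eq)
    qed
    then show ?thesis
      using int_vectors_iso_Suc[OF \<open>comm_group G\<close> H r g dec] by blast
  next
    case True
    then obtain N where N: "N > 0" "g [^]\<^bsub>G\<^esub> (N::nat) \<in> H" by blast
    \<comment> \<open>One exponent works for all of \<open>G\<close>: in a product of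
      \<open>h\<close> and a power of \<open>g\<close>, raising to \<open>N\<close> puts both
      factors into \<open>H\<close>.\<close>
    have NH: "x [^]\<^bsub>G\<^esub> N \<in> H" if x: "x \<in> carrier G" for x
    proof -
      obtain h z where hz: "h \<in> H" "x = h \<otimes>\<^bsub>G\<^esub> g [^]\<^bsub>G\<^esub> (z::int)" using dec[OF x] by blast
      have "(g [^]\<^bsub>G\<^esub> z) [^]\<^bsub>G\<^esub> N = (g [^]\<^bsub>G\<^esub> N) [^]\<^bsub>G\<^esub> z"
        using g by (metis int_pow_int int_pow_pow mult.commute)
      moreover have "(g [^]\<^bsub>G\<^esub> N) [^]\<^bsub>G\<^esub> z \<in> H"
        by (rule subgroup_int_pow_closed[OF H N(2)])
      moreover have "h [^]\<^bsub>G\<^esub> N \<in> H"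
        using GH.nat_pow_closed[of h N] hz(1) pw by simp
      ultimately show ?thesis
        using hz g by (simp add: nat_pow_distrib)
    qed
    obtain \<phi> where \<phi>: "\<phi> \<in> iso (G\<lparr>carrier := H\<rparr>) (int_vectors {..<r::nat})"
      using r by (auto simp: is_iso_def)
    then interpret \<phi>: group_hom "G\<lparr>carrier := H\<rparr>" "int_vectors {..<r::nat}" \<phi>
      by (simp add: group_hom_def group_hom_axioms_def iso_def GH.is_group)
    \<comment> \<open>\<open>x \<mapsto> x\<^sup>N\<close> embeds \<open>G\<close> into the free group \<open>H\<close>.\<close>
    show ?thesis
    proof (rule separated_by_int_homs_imp_free[of G r "\<lambda>i x. \<phi> (x [^]\<^bsub>G\<^esub> N) i", THEN conjunct2])
      show "(\<lambda>x. \<phi> (x [^]\<^bsub>G\<^esub> N) i) \<in> hom G integer_group" if "i < r" for i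
        using that NH \<phi>.hom_mult by (intro homI) (auto simp: nat_pow_distrib)
      show "x = \<one>\<^bsub>G\<^esub>" if x: "x \<in> carrier G" and 0: "\<And>i. i < r \<Longrightarrow> \<phi> (x [^]\<^bsub>G\<^esub> N) i = 0" for x
      proof -
        have "\<phi> (x [^]\<^bsub>G\<^esub> N) \<in> carrier (int_vectors {..<r})" using \<phi>.hom_closed NH[OF x] by simp
        then have "\<phi> (x [^]\<^bsub>G\<^esub> N) = \<one>\<^bsub>int_vectors {..<r}\<^esub>"
          using 0 by (auto simp: PiE_def extensional_def)
        then have "x [^]\<^bsub>G\<^esub> N = \<one>\<^bsub>G\<^esub>" using \<phi> NH[OF x] \<phi>.iso_iff by simp
        then show ?thesis using insert.prems(4) N x by blast
      qed
    qed fact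
  qed
qed

section \<open>The torsion subgroup and the rank of the free part\<close>

lemma fin_gen_hom_image:
  assumes "group_hom G H h" "h ` carrier G = carrier H" "fin_gen G"
  shows "fin_gen H"
proof -
  interpret group_hom G H h by fact
  obtain S where S: "finite S" "S \<subseteq> carrier G" "carrier G = generate G S"
    using assms(3) by (auto simp: fin_gen_def)
  have "carrier H = generate H (h ` S)"
    using generate_img[OF S(2)] S(3) assms(2) by simp
  moreover have "h ` S \<subseteq> carrier H" using S(2) by auto
  ultimately show ?thesis using S(1) unfolding fin_gen_def by (intro exI[of _ "h ` S"]) auto
qed

lemma fin_gen_Mod:
  assumes "N \<lhd> G" "fin_gen G"
  shows "fin_gen (G Mod N)"
proof (rule fin_gen_hom_image[OF _ _ assms(2)])
  interpret normal N G by fact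
  show "group_hom G (G Mod N) ((#>\<^bsub>G\<^esub>) N)"
    using r_coset_hom_Mod factorgroup_is_group by (simp add: group_hom_def group_hom_axioms_def is_group)
  show "(#>\<^bsub>G\<^esub>) N ` carrier G = carrier (G Mod N)" by (simp add: carrier_FactGroup)
qed

lemma subgroup_torsion:
  assumes "comm_group G"
  shows "subgroup (torsion G) G"
proof -
  interpret comm_group G by fact
  show ?thesis
  proof
    show "torsion G \<subseteq> carrier G" by (auto simp: torsion_def)
    show "\<one>\<^bsub>G\<^esub> \<in> torsion G" by (auto simp: torsion_def intro: exI[of _ 1])
  next
    fix x y assume "x \<in> torsion G" "y \<in> torsion G"
    then obtain m m' where *: "x \<in> carrier G" "y \<in> carrier G" "m > 0" "m' > 0"
      "x [^]\<^bsub>G\<^esub> (m::nat) = \<one>\<^bsub>G\<^esub>" "y [^]\<^bsub>G\<^esub> (m'::nat) = \<one>\<^bsub>G\<^esub>"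
      unfolding torsion_def by blast
    have "x [^]\<^bsub>G\<^esub> (m * m') = \<one>\<^bsub>G\<^esub>"
      using *(1,5) nat_pow_pow[of x m m'] by simp
    moreover have "y [^]\<^bsub>G\<^esub> (m * m') = \<one>\<^bsub>G\<^esub>"
      using *(2,6) nat_pow_pow[of y m' m] by (simp add: mult.commute)
    ultimately have "(x \<otimes>\<^bsub>G\<^esub> y) [^]\<^bsub>G\<^esub> (m * m') = \<one>\<^bsub>G\<^esub>"
      using * by (simp add: nat_pow_distrib)
    then show "x \<otimes>\<^bsub>G\<^esub> y \<in> torsion G"
      using * by (auto simp: torsion_def intro!: exI[of _ "m * m'"])
  next
    fix x assume "x \<in> torsion G"
    then show "inv\<^bsub>G\<^esub> x \<in> torsion G"
      by (auto simp: torsion_def nat_pow_inv)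
  qed
qed

text \<open>An element with a torsion power is torsion, since the two exponents multiply. This
  supplies the torsion-freeness from which freeness of the quotient follows.\<close>

lemma Mod_torsion_free:
  assumes "comm_group G" "X \<in> carrier (G Mod torsion G)" "(m::nat) > 0"
    and "X [^]\<^bsub>G Mod torsion G\<^esub> m = \<one>\<^bsub>G Mod torsion G\<^esub>"
  shows "X = \<one>\<^bsub>G Mod torsion G\<^esub>"
proof -
  interpret comm_group G by fact
  have sub: "subgroup (torsion G) G" by (rule subgroup_torsion) fact
  interpret T: normal "torsion G" G using subgroup_imp_normal[OF sub] .
  obtain x where x: "x \<in> carrier G" "X = torsion G #>\<^bsub>G\<^esub> x"
    using assms(2) by (auto simp: carrier_FactGroup)
  have "torsion G #>\<^bsub>G\<^esub> (x [^]\<^bsub>G\<^esub> m) = torsion G"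
    using assms(4) x by (simp add: T.FactGroup_pow)
  then have "x [^]\<^bsub>G\<^esub> m \<in> torsion G"
    using x(1) rcos_self[OF _ sub, of "x [^]\<^bsub>G\<^esub> m"] by simp
  then obtain m' where "m' > 0" "(x [^]\<^bsub>G\<^esub> m) [^]\<^bsub>G\<^esub> (m'::nat) = \<one>\<^bsub>G\<^esub>"
    unfolding torsion_def by blast
  then have "x [^]\<^bsub>G\<^esub> (m * m') = \<one>\<^bsub>G\<^esub>" "m * m' > 0"
    using x(1) assms(3) nat_pow_pow[of x m m'] by simp_all
  then have "x \<in> torsion G"
    using x(1) unfolding torsion_def by blast
  then show ?thesis using x sub by (simp add: coset_join2)
qed

lemma ex_Mod_torsion_iso:
  assumes "comm_group G" "fin_gen G"
  shows "\<exists>r. G Mod torsion G \<cong> int_vectors {..<r::nat}"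
proof -
  interpret comm_group G by fact
  have n: "torsion G \<lhd> G" using subgroup_imp_normal[OF subgroup_torsion[OF assms(1)]] .
  obtain S where "finite S" "S \<subseteq> carrier (G Mod torsion G)"
      "carrier (G Mod torsion G) = generate (G Mod torsion G) S"
    using fin_gen_Mod[OF n assms(2)] by (auto simp: fin_gen_def)
  then show ?thesis
    using Mod_torsion_free[OF assms(1)] abelian_FactGroup[OF subgroup_torsion[OF assms(1)]]
    by (intro torsion_free_fin_gen_imp_free[of S]) auto
qed

text \<open>Justifies the definite description in \<open>free_rank\<close>: existence is freeness of
  the torsion quotient, uniqueness is invariance of rank.\<close>

lemma Mod_torsion_iso_free_rank:
  assumes "comm_group G" "fin_gen G"
  shows "G Mod torsion G \<cong> int_vectors {..<free_rank G}"
proof -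
  interpret comm_group G by fact
  have g: "group (G Mod torsion G)"
    using abelian_FactGroup[OF subgroup_torsion[OF assms(1)]] by (simp add: comm_group.axioms)
  have "r = s" if "G Mod torsion G \<cong> int_vectors {..<r::nat}" "G Mod torsion G \<cong> int_vectors {..<s::nat}" for r s
    using int_vectors_iso_imp_card_eq[of "{..<r}" "{..<s}"] that group.iso_sym[OF g] iso_trans
    by (metis card_lessThan finite_lessThan)
  with ex_Mod_torsion_iso[OF assms] have "\<exists>!r. G Mod torsion G \<cong> int_vectors {..<r::nat}" by blast
  then show ?thesis unfolding free_rank_def by (rule theI')
qed

lemma free_rank_eq_0_iff:
  assumes "comm_group G" "fin_gen G"
  shows "free_rank G = 0 \<longleftrightarrow> torsion G = carrier G"
proof -
  interpret comm_group G by fact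
  have sub: "subgroup (torsion G) G" by (rule subgroup_torsion) fact
  interpret Q: comm_group "G Mod torsion G" by (rule abelian_FactGroup[OF sub])
  have iso: "G Mod torsion G \<cong> int_vectors {..<free_rank G}" by (rule Mod_torsion_iso_free_rank) fact+
  have "free_rank G = 0 \<longleftrightarrow> carrier (G Mod torsion G) = {\<one>\<^bsub>G Mod torsion G\<^esub>}"
  proof
    assume "free_rank G = 0"
    with iso have "G Mod torsion G \<cong> int_vectors {..<0::nat}" by simp
    \<comment> \<open>Over the empty index set \<open>int_vectors\<close> contains a single
      function, the one that is undefined everywhere.\<close>
    then have "card (carrier (G Mod torsion G)) = 1" using iso_same_card by fastforce
    then show "carrier (G Mod torsion G) = {\<one>\<^bsub>G Mod torsion G\<^esub>}"
      by (metis Q.one_closed card_1_singletonE singletonD)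
  next
    assume "carrier (G Mod torsion G) = {\<one>\<^bsub>G Mod torsion G\<^esub>}"
    then have "G Mod torsion G \<cong> int_vectors {..<0::nat}"
      by (rule trivial_iso_int_vectors[OF Q.is_group])
    then show "free_rank G = 0"
      using int_vectors_iso_imp_card_eq[of "{..<free_rank G}" "{..<0::nat}"] iso Q.iso_sym iso_trans
      by (metis card_lessThan finite_lessThan)
  qed
  also have "\<dots> \<longleftrightarrow> torsion G = carrier G"
  proof
    assume *: "carrier (G Mod torsion G) = {\<one>\<^bsub>G Mod torsion G\<^esub>}"
    have "x \<in> torsion G" if "x \<in> carrier G" for x
    proof -
      have "torsion G #>\<^bsub>G\<^esub> x = torsion G" using * that by (auto simp: carrier_FactGroup)
      then show ?thesis using rcos_self[OF that sub] by simp
    qed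
    then show "torsion G = carrier G" by (auto simp: torsion_def)
  next
    assume "torsion G = carrier G"
    then show "carrier (G Mod torsion G) = {\<one>\<^bsub>G Mod torsion G\<^esub>}"
      using coset_join2[OF _ sub] by (auto simp: carrier_FactGroup)
  qed
  finally show ?thesis .
qed

text \<open>An isomorphism matches the torsion subgroups and so induces one of the quotients. The
  two predicates under \<open>THE\<close> then agree for every \<open>r\<close>, which makes the
  described numbers equal.\<close>

lemma free_rank_iso:
  assumes "comm_group G" "comm_group H" "G \<cong> H"
  shows "free_rank G = free_rank H"
proof -
  interpret G: comm_group G by fact
  interpret H: comm_group H by fact
  obtain h where h: "h \<in> iso G H" using assms(3) by (auto simp: is_iso_def)
  then interpret h: group_hom G H h
    by (simp add: group_hom_def group_hom_axioms_def iso_def G.is_group H.is_group)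
  have hb: "h ` carrier G = carrier H" using h by (auto simp: iso_def bij_betw_def)
  have sub: "subgroup (torsion H) H" by (rule subgroup_torsion) fact
  interpret T: normal "torsion H" H using H.subgroup_imp_normal[OF sub] .
  let ?q = "\<lambda>x. torsion H #>\<^bsub>H\<^esub> h x"
  have hq: "?q \<in> hom G (H Mod torsion H)"
    using hom_compose[OF h.homh T.r_coset_hom_Mod] by (simp add: comp_def)
  interpret q: group_hom G "H Mod torsion H" ?q
    using hq T.factorgroup_is_group by (simp add: group_hom_def group_hom_axioms_def G.is_group)
  have tor: "h x \<in> torsion H \<longleftrightarrow> x \<in> torsion G" if "x \<in> carrier G" for x
  proof -
    have "h (x [^]\<^bsub>G\<^esub> m) = \<one>\<^bsub>H\<^esub> \<longleftrightarrow> x [^]\<^bsub>G\<^esub> m = \<one>\<^bsub>G\<^esub>" for m :: nat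
      using h that h.hom_one unfolding h.iso_iff by auto
    then have "h x [^]\<^bsub>H\<^esub> m = \<one>\<^bsub>H\<^esub> \<longleftrightarrow> x [^]\<^bsub>G\<^esub> m = \<one>\<^bsub>G\<^esub>" for m :: nat
      unfolding h.hom_nat_pow[OF that, symmetric] .
    then show ?thesis using that h.hom_closed unfolding torsion_def by blast
  qed
  have "kernel G (H Mod torsion H) ?q = torsion G"
  proof -
    have "?q x = torsion H \<longleftrightarrow> h x \<in> torsion H" if "x \<in> carrier G" for x
      using that H.coset_join2[OF _ sub] H.rcos_self[OF _ sub, of "h x"] by auto
    moreover have "torsion G \<subseteq> carrier G" unfolding torsion_def by blast
    ultimately show ?thesis using tor unfolding kernel_def one_FactGroup by blast
  qed
  moreover have "?q ` carrier G = carrier (H Mod torsion H)"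
    unfolding carrier_FactGroup hb[symmetric] by blast
  ultimately have iso: "G Mod torsion G \<cong> H Mod torsion H"
    using q.FactGroup_iso by simp
  have iso': "H Mod torsion H \<cong> G Mod torsion G"
    using iso comm_group.axioms(2)[OF G.abelian_FactGroup[OF subgroup_torsion[OF assms(1)]]]
    by (rule group.iso_sym[rotated])
  have "G Mod torsion G \<cong> int_vectors {..<r} \<longleftrightarrow> H Mod torsion H \<cong> int_vectors {..<r}" for r :: nat
    using iso_trans[OF iso', of "int_vectors {..<r}"]
      iso_trans[OF iso, of "int_vectors {..<r}"] by blast
  then show ?thesis unfolding free_rank_def by simp
qed

section \<open>Integer matrices over the rationals\<close>

text \<open>The scalar multiplication is the one in \<open>submatrix_rank\<close>, so
  \<open>rat_fun.dim\<close> is the dimension used there.\<close>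

interpretation rat_fun: vector_space "\<lambda>(q::rat) (v::'a \<Rightarrow> rat) \<sigma>. q * v \<sigma>"
  by unfold_locales (auto simp: algebra_simps)

definition inj_matrix :: "('r \<Rightarrow> 'c \<Rightarrow> int) \<Rightarrow> 'r set \<Rightarrow> 'c set \<Rightarrow> bool" where
  "inj_matrix M A B \<longleftrightarrow> (\<forall>c. (\<forall>\<sigma>\<in>A. (\<Sum>\<tau>\<in>B. M \<sigma> \<tau> * c \<tau>) = 0) \<longrightarrow> (\<forall>\<tau>\<in>B. c \<tau> = 0))"

text \<open>Surjectivity over the rationals, or equivalently a torsion cokernel. The integral
  wording with a multiplier \<open>m\<close> is the one in which a vanishing Betti number presents
  itself.\<close>

definition rat_surj_matrix :: "('r \<Rightarrow> 'c \<Rightarrow> int) \<Rightarrow> 'r set \<Rightarrow> 'c set \<Rightarrow> bool" where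
  "rat_surj_matrix M A B \<longleftrightarrow>
     (\<forall>v. \<exists>m>0. \<exists>c. \<forall>\<sigma>\<in>A. (\<Sum>\<tau>\<in>B. M \<sigma> \<tau> * c \<tau>) = m * v \<sigma>)"

definition column :: "('r \<Rightarrow> 'c \<Rightarrow> int) \<Rightarrow> 'r set \<Rightarrow> 'c \<Rightarrow> 'r \<Rightarrow> rat" where
  "column M A \<tau> = (\<lambda>\<sigma>. if \<sigma> \<in> A then rat_of_int (M \<sigma> \<tau>) else 0)"

lemma sum_fun_apply: "(\<Sum>x\<in>S. f x) y = (\<Sum>x\<in>S. f x y)" for f :: "'a \<Rightarrow> 'b \<Rightarrow> rat"
  by (induction S rule: infinite_finite_induct) auto

text \<open>Turns a rational linear relation among columns into an integral one, to which
  \<open>inj_matrix\<close> applies.\<close>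

lemma common_denominator:
  fixes q :: "'a \<Rightarrow> rat"
  assumes "finite B"
  shows "\<exists>m>0. \<exists>c. \<forall>x\<in>B. rat_of_int m * q x = rat_of_int (c x)"
  using assms
proof induction
  case empty
  show ?case by (intro exI[of _ 1]) auto
next
  case (insert b B)
  then obtain m c where m: "m > 0" "\<forall>x\<in>B. rat_of_int m * q x = rat_of_int (c x)" by blast
  obtain p d where pd: "d > 0" "q b = rat_of_int p / rat_of_int d"
    by (metis quotient_of_denom_pos' quotient_of_div surjective_pairing)
  define c' where "c' x = (if x = b then m * p else d * c x)" for x
  have "rat_of_int (m * d) * q x = rat_of_int (c' x)" if "x \<in> insert b B" for x
  proof (cases "x = b")
    case True
    then show ?thesis using pd by (simp add: c'_def)
  next
    case False
    then have "rat_of_int m * q x = rat_of_int (c x)" using that m by blast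
    then show ?thesis using False by (simp add: c'_def mult.commute mult.left_commute)
  qed
  then have "\<forall>x\<in>insert b B. rat_of_int (m * d) * q x = rat_of_int (c' x)" by blast
  moreover have "m * d > 0" using m pd by simp
  ultimately show ?case by blast
qed

lemma inj_matrix_columns:
  assumes "finite B" "inj_matrix M A B"
  shows "inj_on (column M A) B" "rat_fun.independent (column M A ` B)"
proof -
  show inj: "inj_on (column M A) B"
  proof (rule inj_onI, rule ccontr)
    fix \<tau> \<tau>' assume *: "\<tau> \<in> B" "\<tau>' \<in> B" "column M A \<tau> = column M A \<tau>'" "\<tau> \<noteq> \<tau>'"
    \<comment> \<open>Two equal columns would put the difference of two unit vectors into the
      kernel.\<close>
    define c where "c \<rho> = (if \<rho> = \<tau> then 1 else if \<rho> = \<tau>' then -1 else 0 :: int)" for \<rho>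
    have "(\<Sum>\<rho>\<in>B. M \<sigma> \<rho> * c \<rho>) = 0" if "\<sigma> \<in> A" for \<sigma>
    proof -
      have "(\<Sum>\<rho>\<in>B. M \<sigma> \<rho> * c \<rho>) = (\<Sum>\<rho>\<in>{\<tau>, \<tau>'}. M \<sigma> \<rho> * c \<rho>)"
        using * assms(1) by (intro sum.mono_neutral_right) (auto simp: c_def)
      also have "\<dots> = 0"
        using fun_cong[OF *(3), of \<sigma>] *(4) that by (simp add: c_def column_def)
      finally show ?thesis .
    qed
    then have "c \<tau> = 0" using assms(2) *(1) unfolding inj_matrix_def by blast
    then show False by (simp add: c_def)
  qed
  show "rat_fun.independent (column M A ` B)"
    unfolding rat_fun.dependent_explicit
  proof (intro notI, elim exE conjE bexE)
    fix t u v assume t: "finite t" "t \<subseteq> column M A ` B" "(\<Sum>v\<in>t. (\<lambda>\<sigma>. u v * v \<sigma>)) = 0" "v \<in> t" "u v \<noteq> 0"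
    \<comment> \<open>The relation is indexed by a set of columns; \<open>q\<close> pulls its
      coefficients back to column indices, with 0 for columns outside \<open>t\<close>.\<close>
    define q where "q \<tau> = (if column M A \<tau> \<in> t then u (column M A \<tau>) else 0)" for \<tau>
    have rel: "(\<Sum>\<tau>\<in>B. q \<tau> * rat_of_int (M \<sigma> \<tau>)) = 0" if "\<sigma> \<in> A" for \<sigma>
    proof -
      have "(\<Sum>\<tau>\<in>B. q \<tau> * rat_of_int (M \<sigma> \<tau>)) = (\<Sum>\<tau>\<in>B. q \<tau> * column M A \<tau> \<sigma>)"
        using that by (simp add: column_def)
      also have "\<dots> = (\<Sum>v\<in>column M A ` B. (if v \<in> t then u v else 0) * v \<sigma>)"
        by (simp add: sum.reindex[OF inj] q_def)
      also have "\<dots> = (\<Sum>v\<in>t. u v * v \<sigma>)"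
        using t(2) assms(1) by (intro sum.mono_neutral_cong_right) auto
      also have "\<dots> = 0" using fun_cong[OF t(3), of \<sigma>] by (simp add: sum_fun_apply)
      finally show ?thesis .
    qed
    obtain m c where mc: "m > 0" "\<forall>\<tau>\<in>B. rat_of_int m * q \<tau> = rat_of_int (c \<tau>)"
      using common_denominator[OF assms(1), of q] by blast
    have "(\<Sum>\<tau>\<in>B. M \<sigma> \<tau> * c \<tau>) = 0" if "\<sigma> \<in> A" for \<sigma>
    proof -
      have "rat_of_int (\<Sum>\<tau>\<in>B. M \<sigma> \<tau> * c \<tau>) = (\<Sum>\<tau>\<in>B. rat_of_int (M \<sigma> \<tau>) * (rat_of_int m * q \<tau>))"
        using mc(2) by simp
      also have "\<dots> = rat_of_int m * (\<Sum>\<tau>\<in>B. q \<tau> * rat_of_int (M \<sigma> \<tau>))"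
        by (simp add: sum_distrib_left mult_ac)
      also have "\<dots> = 0" using rel[OF that] by simp
      finally show ?thesis by (simp only: of_int_eq_0_iff)
    qed
    then have c0: "\<forall>\<tau>\<in>B. c \<tau> = 0" using assms(2) unfolding inj_matrix_def by blast
    obtain \<tau> where "\<tau> \<in> B" "v = column M A \<tau>" using t(2,4) by blast
    then show False using c0 mc t(4,5) by (auto simp: q_def)
  qed
qed

section \<open>Counting rows and columns by dimension\<close>

definition unit_fun :: "'a \<Rightarrow> 'a \<Rightarrow> rat" where
  "unit_fun \<sigma> = (\<lambda>\<rho>. if \<rho> = \<sigma> then 1 else 0)"

lemma inj_unit_fun: "inj_on unit_fun A"
  by (intro inj_onI) (auto simp: unit_fun_def fun_eq_iff split: if_splits)

lemma independent_unit_fun: "rat_fun.independent (unit_fun ` A)"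
  unfolding rat_fun.dependent_explicit
proof (intro notI, elim exE conjE bexE)
  fix t u v assume t: "finite t" "t \<subseteq> unit_fun ` A" "(\<Sum>v\<in>t. (\<lambda>\<sigma>. u v * v \<sigma>)) = 0" "v \<in> t" "u v \<noteq> 0"
  then obtain \<sigma> where \<sigma>: "v = unit_fun \<sigma>" by blast
  have "0 = (\<Sum>w\<in>t. u w * w \<sigma>)" using fun_cong[OF t(3), of \<sigma>] by (simp add: sum_fun_apply)
  also have "\<dots> = (\<Sum>w\<in>{v}. u w * w \<sigma>)"
  proof (rule sum.mono_neutral_right)
    show "\<forall>w\<in>t - {v}. u w * w \<sigma> = 0"
    proof
      fix w assume w: "w \<in> t - {v}"
      then obtain \<sigma>' where "w = unit_fun \<sigma>'" using t(2) by blast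
      with w \<sigma> have "\<sigma>' \<noteq> \<sigma>" "w = unit_fun \<sigma>'" by auto
      then show "u w * w \<sigma> = 0" by (simp add: unit_fun_def)
    qed
  qed (use t in auto)
  also have "\<dots> = u v" using \<sigma> by (simp add: unit_fun_def)
  finally show False using t(5) by simp
qed

lemma column_in_span_unit_fun:
  assumes "finite A"
  shows "column M A \<tau> \<in> rat_fun.span (unit_fun ` A)"
proof -
  have "column M A \<tau> = (\<Sum>\<sigma>\<in>A. (\<lambda>\<rho>. column M A \<tau> \<sigma> * unit_fun \<sigma> \<rho>))"
  proof (rule ext)
    fix \<rho>
    have "(\<Sum>\<sigma>\<in>A. column M A \<tau> \<sigma> * unit_fun \<sigma> \<rho>) = (\<Sum>\<sigma>\<in>A. if \<sigma> = \<rho> then column M A \<tau> \<rho> else 0)"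
      by (rule sum.cong) (auto simp: unit_fun_def)
    also have "\<dots> = column M A \<tau> \<rho>" using assms by (simp add: column_def)
    finally show "column M A \<tau> \<rho> = (\<Sum>\<sigma>\<in>A. (\<lambda>\<rho>. column M A \<tau> \<sigma> * unit_fun \<sigma> \<rho>)) \<rho>"
      by (simp add: sum_fun_apply)
  qed
  also have "\<dots> \<in> rat_fun.span (unit_fun ` A)"
    by (intro rat_fun.span_sum rat_fun.span_scale rat_fun.span_base) auto
  finally show ?thesis .
qed

lemma inj_matrix_card_le:
  assumes "finite A" "finite B" "inj_matrix M A B"
  shows "card B \<le> card A"
proof -
  have sub: "column M A ` B \<subseteq> rat_fun.span (unit_fun ` A)"
    using column_in_span_unit_fun[OF assms(1)] by (rule image_subsetI)
  have "card (column M A ` B) \<le> card (unit_fun ` A)"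
    using rat_fun.independent_span_bound[OF _ inj_matrix_columns(2)[OF assms(2,3)] sub] assms(1) by simp
  then show ?thesis
    by (simp add: card_image inj_unit_fun inj_matrix_columns(1)[OF assms(2,3)])
qed

text \<open>Apply rational surjectivity to the indicator of \<sigma> and divide the resulting
  coefficients by the multiplier.\<close>

lemma rat_surj_matrix_unit_fun:
  assumes "rat_surj_matrix M A B" "\<sigma> \<in> A"
  shows "unit_fun \<sigma> \<in> rat_fun.span (column M A ` B)"
proof -
  obtain m c where m: "m > 0" "\<forall>\<rho>\<in>A. (\<Sum>\<tau>\<in>B. M \<rho> \<tau> * c \<tau>) = m * (if \<rho> = \<sigma> then 1 else 0)"
    using spec[OF assms(1)[unfolded rat_surj_matrix_def], of "\<lambda>\<rho>. if \<rho> = \<sigma> then 1 else 0"] by blast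
  have "unit_fun \<sigma> = (\<Sum>\<tau>\<in>B. (\<lambda>\<rho>. (rat_of_int (c \<tau>) / rat_of_int m) * column M A \<tau> \<rho>))"
  proof (rule ext)
    fix \<rho>
    show "unit_fun \<sigma> \<rho> = (\<Sum>\<tau>\<in>B. (\<lambda>\<rho>. (rat_of_int (c \<tau>) / rat_of_int m) * column M A \<tau> \<rho>)) \<rho>"
    proof (cases "\<rho> \<in> A")
      case True
      have "(\<Sum>\<tau>\<in>B. rat_of_int (M \<rho> \<tau>) * rat_of_int (c \<tau>)) = rat_of_int (\<Sum>\<tau>\<in>B. M \<rho> \<tau> * c \<tau>)"
        by simp
      also have "\<dots> = rat_of_int m * (if \<rho> = \<sigma> then 1 else 0)"
        using m(2) True by (cases "\<rho> = \<sigma>") auto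
      finally have "(\<Sum>\<tau>\<in>B. rat_of_int (M \<rho> \<tau>) * rat_of_int (c \<tau>)) = rat_of_int m * (if \<rho> = \<sigma> then 1 else 0)" .
      moreover have "(\<Sum>\<tau>\<in>B. (rat_of_int (c \<tau>) / rat_of_int m) * column M A \<tau> \<rho>)
         = (\<Sum>\<tau>\<in>B. rat_of_int (M \<rho> \<tau>) * rat_of_int (c \<tau>)) / rat_of_int m"
        using True by (simp add: column_def sum_divide_distrib mult.commute)
      ultimately show ?thesis using m(1) by (simp add: sum_fun_apply unit_fun_def)
    next
      case False
      then show ?thesis using assms(2) by (auto simp: sum_fun_apply unit_fun_def column_def)
    qed
  qed
  also have "\<dots> \<in> rat_fun.span (column M A ` B)"
    by (intro rat_fun.span_sum rat_fun.span_scale rat_fun.span_base) auto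
  finally show ?thesis .
qed

text \<open>The columns span all unit vectors of \<open>A\<close>, so any finite \<open>t\<close>
  spanning the columns has at least \<open>card A\<close> elements. Allowing \<open>t\<close> other
  than the full set of columns makes it possible to test whether a column is redundant.\<close>

lemma rat_surj_matrix_card_le:
  assumes "finite A" "finite B" "rat_surj_matrix M A B" "column M A ` B \<subseteq> rat_fun.span t" "finite t"
  shows "card A \<le> card t"
proof -
  have "unit_fun ` A \<subseteq> rat_fun.span t"
    using rat_surj_matrix_unit_fun[OF assms(3)] rat_fun.span_minimal[OF assms(4) rat_fun.subspace_span] by blast
  then have "card (unit_fun ` A) \<le> card t"
    using rat_fun.independent_span_bound[OF assms(5) independent_unit_fun[of A]] by blast
  then show ?thesis by (simp add: card_image inj_unit_fun)
qed

text \<open>A repeated column, or one in the span of the others, would leave fewer than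
  \<open>card A\<close> vectors spanning a space that needs \<open>card A\<close>. So the columns
  are distinct and independent, and an integral kernel vector is a relation among them.\<close>

lemma square_rat_surj_imp_inj_matrix:
  assumes "finite A" "finite B" "rat_surj_matrix M A B" "card A = card B"
  shows "inj_matrix M A B"
proof -
  let ?t = "column M A ` B"
  have ft: "finite ?t" using assms(2) by simp
  have ct: "card A \<le> card ?t"
    using rat_surj_matrix_card_le[OF assms(1-3) _ ft] rat_fun.span_superset by blast
  then have inj: "inj_on (column M A) B"
    using assms(2,4) card_image_le[OF assms(2), of "column M A"] by (intro eq_card_imp_inj_on) auto
  have ind: "rat_fun.independent ?t"
  proof
    assume "rat_fun.dependent ?t"
    then obtain x where x: "x \<in> ?t" "x \<in> rat_fun.span (?t - {x})"
      unfolding rat_fun.dependent_def by blast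
    have "?t \<subseteq> rat_fun.span (?t - {x})"
    proof
      fix y assume "y \<in> ?t"
      then show "y \<in> rat_fun.span (?t - {x})"
        using x(2) rat_fun.span_base[of y "?t - {x}"] by (cases "y = x") simp_all
    qed
    then have "card A \<le> card (?t - {x})"
      by (rule rat_surj_matrix_card_le[OF assms(1-3)]) (simp add: ft)
    moreover have "card (?t - {x}) < card ?t" using x(1) ft by (meson card_Diff1_less)
    moreover have "card ?t \<le> card B" using assms(2) by (rule card_image_le)
    ultimately show False using assms(4) by linarith
  qed
  show ?thesis
    unfolding inj_matrix_def
  proof (intro allI impI ballI)
    fix c \<tau> assume c: "\<forall>\<sigma>\<in>A. (\<Sum>\<tau>\<in>B. M \<sigma> \<tau> * c \<tau>) = 0" and \<tau>: "\<tau> \<in> B"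
    \<comment> \<open>Moves the coefficients from column indices to the columns themselves, which is
      well defined because distinct indices have distinct columns.\<close>
    define u where "u v = rat_of_int (c (the_inv_into B (column M A) v))" for v
    have u: "u (column M A \<rho>) = rat_of_int (c \<rho>)" if "\<rho> \<in> B" for \<rho>
      using that inj by (simp add: u_def the_inv_into_f_f)
    have "(\<Sum>v\<in>?t. (\<lambda>\<sigma>. u v * v \<sigma>)) = 0"
    proof (rule ext)
      fix \<sigma>
      have "(\<Sum>v\<in>?t. (\<lambda>\<sigma>. u v * v \<sigma>)) \<sigma> = (\<Sum>\<rho>\<in>B. rat_of_int (c \<rho>) * column M A \<rho> \<sigma>)"
        using u by (simp add: sum_fun_apply sum.reindex[OF inj])
      also have "\<dots> = (if \<sigma> \<in> A then rat_of_int (\<Sum>\<tau>\<in>B. M \<sigma> \<tau> * c \<tau>) else 0)"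
        by (simp add: column_def mult.commute)
      also have "\<dots> = 0" using c by simp
      finally show "(\<Sum>v\<in>?t. (\<lambda>\<sigma>. u v * v \<sigma>)) \<sigma> = 0 \<sigma>" by simp
    qed
    then have "u (column M A \<tau>) = 0"
      using rat_fun.independentD[OF ind ft subset_refl] \<tau> by blast
    then show "c \<tau> = 0" using u[OF \<tau>] by simp
  qed
qed

lemma submatrix_rank_eq_card:
  assumes "finite B'" "B' \<subseteq> B" "inj_matrix M A B'"
    and "\<And>\<tau>. \<tau> \<in> B \<Longrightarrow> column M A \<tau> \<in> rat_fun.span (column M A ` B')"
  shows "submatrix_rank M A B = card B'"
proof -
  have "rat_fun.span (column M A ` B') = rat_fun.span (column M A ` B)"
    using assms(2,4) by (intro rat_fun.span_eq[THEN iffD2] conjI) (auto intro: rat_fun.span_base)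
  then have "rat_fun.dim (column M A ` B) = card (column M A ` B')"
    using rat_fun.dim_eq_card inj_matrix_columns(2)[OF assms(1,3)] by blast
  then show ?thesis
    using inj_matrix_columns(1)[OF assms(1,3)]
    unfolding submatrix_rank_def column_def[symmetric] by (simp add: card_image)
qed

section \<open>The boundary of the boundary\<close>

text \<open>The position of a vertex in the increasing list is the number of smaller vertices. Signs
  written this way can be followed through deletion and insertion without reference to
  lists.\<close>

lemma bdry_eq_sum:
  assumes "finite \<tau>"
  shows "bdry \<sigma> \<tau> = (\<Sum>x\<in>\<tau>. if \<sigma> = \<tau> - {x} then (-1) ^ card {y \<in> \<tau>. y < x} else 0)"
proof -
  let ?l = "sorted_list_of_set \<tau>"
  have l: "sorted_wrt (<) ?l" "set ?l = \<tau>" "length ?l = card \<tau>" "distinct ?l"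
    using assms by (auto simp: strict_sorted_list_of_set)
  have bij: "bij_betw ((!) ?l) {..<card \<tau>} \<tau>"
    using bij_betw_nth[of ?l "{..<card \<tau>}" \<tau>] l by simp
  have card: "card {y \<in> \<tau>. y < ?l ! i} = i" if i: "i < card \<tau>" for i
  proof -
    have "{y \<in> \<tau>. y < ?l ! i} = (!) ?l ` {..<i}"
    proof (intro equalityI subsetI)
      fix y assume y: "y \<in> {y \<in> \<tau>. y < ?l ! i}"
      then obtain j where j: "j < card \<tau>" "y = ?l ! j" using l(2,3) by (metis (no_types, lifting) in_set_conv_nth mem_Collect_eq)
      have "j < i"
      proof (rule ccontr)
        assume "\<not> j < i"
        then have "?l ! i \<le> ?l ! j"
          using sorted_wrt_nth_less[OF l(1), of i j] j(1) l(3) by (cases "i = j") auto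
        then show False using y j by simp
      qed
      then show "y \<in> (!) ?l ` {..<i}" using j by simp
    next
      fix y assume "y \<in> (!) ?l ` {..<i}"
      then obtain j where j: "j < i" "y = ?l ! j" by blast
      then show "y \<in> {y \<in> \<tau>. y < ?l ! i}"
        using sorted_wrt_nth_less[OF l(1) j(1)] i l(2,3) nth_mem[of j ?l] by simp
    qed
    moreover have "inj_on ((!) ?l) {..<i}"
      using bij i by (auto simp: bij_betw_def intro: inj_on_subset)
    ultimately show ?thesis by (simp add: card_image)
  qed
  show ?thesis
    unfolding bdry_def sum.reindex_bij_betw[OF bij, symmetric]
    by (intro sum.cong) (simp_all add: card)
qed

lemma bdry_0: "finite \<tau> \<Longrightarrow> (\<And>x. x \<in> \<tau> \<Longrightarrow> \<sigma> \<noteq> \<tau> - {x}) \<Longrightarrow> bdry \<sigma> \<tau> = 0"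
  by (simp add: bdry_eq_sum)

text \<open>Deleting two vertices in either order gives opposite signs, so the terms cancel in
  pairs. \<open>S\<close> has to contain only those facets of \<upsilon> whose boundary involves
  \<sigma>.\<close>

lemma bdry_bdry:
  assumes "finite \<upsilon>" "finite S"
    and facets: "\<And>x. x \<in> \<upsilon> \<Longrightarrow> \<upsilon> - {x} \<notin> S \<Longrightarrow> bdry \<sigma> (\<upsilon> - {x}) = 0"
  shows "(\<Sum>\<tau>\<in>S. bdry \<sigma> \<tau> * bdry \<tau> \<upsilon>) = 0"
proof -
  let ?s = "\<lambda>x \<tau>. (-1::int) ^ card {y \<in> \<tau>. y < x}"
  \<comment> \<open>The signed contribution to \<sigma> of deleting \<open>x\<close> first and
    \<open>y\<close> second.\<close>
  define f where "f x y = (if x \<noteq> y \<and> \<sigma> = \<upsilon> - {x} - {y} then ?s x \<upsilon> * ?s y (\<upsilon> - {x}) else 0)" for x y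
  have "(\<Sum>\<tau>\<in>S. bdry \<sigma> \<tau> * bdry \<tau> \<upsilon>)
      = (\<Sum>\<tau>\<in>S. \<Sum>x\<in>\<upsilon>. if \<tau> = \<upsilon> - {x} then bdry \<sigma> \<tau> * ?s x \<upsilon> else 0)"
    by (simp add: bdry_eq_sum[OF assms(1)] sum_distrib_left if_distrib cong: if_cong)
  also have "\<dots> = (\<Sum>x\<in>\<upsilon>. \<Sum>\<tau>\<in>S. if \<tau> = \<upsilon> - {x} then bdry \<sigma> (\<upsilon> - {x}) * ?s x \<upsilon> else 0)"
    by (subst sum.swap) (intro sum.cong refl, simp)
  also have "\<dots> = (\<Sum>x\<in>\<upsilon>. bdry \<sigma> (\<upsilon> - {x}) * ?s x \<upsilon>)"
    using facets assms(2) by (intro sum.cong) (auto simp: sum.delta)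
  also have "\<dots> = (\<Sum>x\<in>\<upsilon>. \<Sum>y\<in>\<upsilon>. f x y)"
  proof (rule sum.cong)
    fix x assume "x \<in> \<upsilon>"
    have "bdry \<sigma> (\<upsilon> - {x}) * ?s x \<upsilon> = (\<Sum>y\<in>\<upsilon> - {x}. f x y)"
      unfolding bdry_eq_sum[OF finite_Diff[OF assms(1)]] sum_distrib_right
      by (rule sum.cong) (auto simp: f_def)
    also have "\<dots> = (\<Sum>y\<in>\<upsilon>. f x y)"
      using assms(1) by (intro sum.mono_neutral_left) (auto simp: f_def)
    finally show "bdry \<sigma> (\<upsilon> - {x}) * ?s x \<upsilon> = (\<Sum>y\<in>\<upsilon>. f x y)" .
  qed simp
  finally have eq: "(\<Sum>\<tau>\<in>S. bdry \<sigma> \<tau> * bdry \<tau> \<upsilon>) = (\<Sum>x\<in>\<upsilon>. \<Sum>y\<in>\<upsilon>. f x y)" .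
  \<comment> \<open>Removing the smaller vertex moves the larger one down by one place, while
    removing the larger does not affect the smaller.\<close>
  have lt: "f x y = - f y x" if "x < y" "x \<in> \<upsilon>" "y \<in> \<upsilon>" for x y
  proof -
    have "{z \<in> \<upsilon> - {y}. z < x} = {z \<in> \<upsilon>. z < x}" using that(1) by auto
    then have 1: "?s x (\<upsilon> - {y}) = ?s x \<upsilon>" by simp
    have "{z \<in> \<upsilon>. z < y} = insert x {z \<in> \<upsilon> - {x}. z < y}" using that by auto
    then have "card {z \<in> \<upsilon>. z < y} = Suc (card {z \<in> \<upsilon> - {x}. z < y})" using assms(1) by simp
    then have 2: "?s y \<upsilon> = - ?s y (\<upsilon> - {x})" by simp
    have 3: "\<upsilon> - {y} - {x} = \<upsilon> - {x} - {y}" by auto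
    have "f y x = (if \<sigma> = \<upsilon> - {x} - {y} then ?s y \<upsilon> * ?s x \<upsilon> else 0)"
      unfolding f_def 1 3 using that(1) by simp
    moreover have "f x y = (if \<sigma> = \<upsilon> - {x} - {y} then ?s x \<upsilon> * ?s y (\<upsilon> - {x}) else 0)"
      unfolding f_def using that(1) by simp
    ultimately show ?thesis unfolding 2 by simp
  qed
  have anti: "f x y = - f y x" if "x \<in> \<upsilon>" "y \<in> \<upsilon>" for x y
    using lt[of x y] lt[of y x] that by (cases x y rule: linorder_cases) (auto simp: f_def)
  have "(\<Sum>x\<in>\<upsilon>. \<Sum>y\<in>\<upsilon>. f x y) = (\<Sum>x\<in>\<upsilon>. \<Sum>y\<in>\<upsilon>. - f y x)"
    by (intro sum.cong refl anti)
  also have "\<dots> = - (\<Sum>x\<in>\<upsilon>. \<Sum>y\<in>\<upsilon>. f x y)"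
    by (subst sum.swap) (simp add: sum_negf)
  finally show ?thesis using eq by simp
qed

text \<open>The apex is the last vertex of \<open>insert n \<tau>\<close>: all of \<tau> precedes
  it, which gives its sign, and it precedes no vertex of \<tau>, so their signs do not
  change.\<close>

lemma bdry_insert_apex:
  assumes "finite \<tau>" "\<And>x. x \<in> \<tau> \<Longrightarrow> x < n" "n \<notin> \<sigma>"
  shows "bdry \<sigma> (insert n \<tau>) = (if \<sigma> = \<tau> then (-1) ^ card \<tau> else 0)"
    and "bdry (insert n \<sigma>) (insert n \<tau>) = bdry \<sigma> \<tau>"
proof -
  have n: "n \<notin> \<tau>" using assms(2) by blast
  have c: "{y. (y = n \<or> y \<in> \<tau>) \<and> y < n} = \<tau>" using assms(2) by auto
  have d: "insert n \<tau> - {n} = \<tau>" using n by auto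
  have x: "{y \<in> insert n \<tau>. y < x} = {y \<in> \<tau>. y < x}" "insert n \<tau> - {x} = insert n (\<tau> - {x})"
    "\<sigma> \<noteq> insert n (\<tau> - {x})" "insert n \<sigma> = insert n (\<tau> - {x}) \<longleftrightarrow> \<sigma> = \<tau> - {x}" if "x \<in> \<tau>" for x
    using that assms(2)[OF that] assms(3) n by auto
  show "bdry \<sigma> (insert n \<tau>) = (if \<sigma> = \<tau> then (-1) ^ card \<tau> else 0)"
    using assms(1) n by (subst bdry_eq_sum) (auto simp: c d x)
  have "insert n \<sigma> \<noteq> \<tau>" using n by auto
  then show "bdry (insert n \<sigma>) (insert n \<tau>) = bdry \<sigma> \<tau>"
    using assms(1) n by (simp add: bdry_eq_sum c d x, intro sum.cong refl) (simp only: x(1))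
qed

section \<open>Homology of cell complexes\<close>

text \<open>Chains are arbitrary functions and rows arbitrary sets, so the same chain can be read in
  several complexes; extensionality is imposed only where \<open>int_vectors\<close> demands
  it.\<close>

definition bd :: "nat set set \<Rightarrow> (nat set \<Rightarrow> int) \<Rightarrow> nat set \<Rightarrow> int" where
  "bd S z \<sigma> = (\<Sum>\<tau>\<in>S. bdry \<sigma> \<tau> * z \<tau>)"

text \<open>The second conjunct is an entry of the product of consecutive boundary matrices. Closure
  under subsets is not asked for, so relative complexes qualify.\<close>

definition cell_complex :: "(int \<Rightarrow> nat set set) \<Rightarrow> bool" where
  "cell_complex C \<longleftrightarrow> (\<forall>j. finite (C j)) \<and>
     (\<forall>j. \<forall>\<sigma>\<in>C (j - 1). \<forall>\<upsilon>\<in>C (j + 1). bd (C j) (\<lambda>\<tau>. bdry \<tau> \<upsilon>) \<sigma> = 0)"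

definition cycle_group :: "(int \<Rightarrow> nat set set) \<Rightarrow> int \<Rightarrow> (nat set \<Rightarrow> int) monoid" where
  "cycle_group C j = (int_vectors (C j))
     \<lparr>carrier := {z \<in> C j \<rightarrow>\<^sub>E UNIV. \<forall>\<sigma>\<in>C (j - 1). bd (C j) z \<sigma> = 0}\<rparr>"

text \<open>\<open>w\<close> may be any function because \<open>bd\<close> sees only its values on
  \<open>C (j + 1)\<close>.\<close>

definition boundaries :: "(int \<Rightarrow> nat set set) \<Rightarrow> int \<Rightarrow> (nat set \<Rightarrow> int) set" where
  "boundaries C j = {z \<in> C j \<rightarrow>\<^sub>E UNIV. \<exists>w. \<forall>\<sigma>\<in>C j. bd (C (j + 1)) w \<sigma> = z \<sigma>}"

lemma bd_add: "bd S (\<lambda>\<tau>. x \<tau> + y \<tau>) \<sigma> = bd S x \<sigma> + bd S y \<sigma>"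
  by (simp add: bd_def algebra_simps sum.distrib)

lemma bd_diff: "bd S (\<lambda>\<tau>. x \<tau> - y \<tau>) \<sigma> = bd S x \<sigma> - bd S y \<sigma>"
  by (simp add: bd_def algebra_simps sum_subtractf)

lemma bd_mult: "bd S (\<lambda>\<tau>. m * x \<tau>) \<sigma> = m * bd S x \<sigma>"
  by (simp add: bd_def algebra_simps sum_distrib_left)

lemma bd_0 [simp]: "bd S (\<lambda>\<tau>. 0) \<sigma> = 0"
  by (simp add: bd_def)

lemma bd_cong: "(\<And>\<tau>. \<tau> \<in> S \<Longrightarrow> x \<tau> = y \<tau>) \<Longrightarrow> bd S x \<sigma> = bd S y \<sigma>"
  by (simp add: bd_def)

lemma bd_restrict [simp]: "bd S (restrict x S) \<sigma> = bd S x \<sigma>"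
  by (rule bd_cong) simp

lemma bd_subset:
  assumes "finite S" "S' \<subseteq> S"
  shows "bd S (\<lambda>\<tau>. if \<tau> \<in> S' then x \<tau> else 0) \<sigma> = bd S' x \<sigma>"
  unfolding bd_def using assms by (intro sum.mono_neutral_cong_right) auto

lemma bd_Un: "finite S \<Longrightarrow> S' \<subseteq> S \<Longrightarrow> bd S x \<sigma> = bd S' x \<sigma> + bd (S - S') x \<sigma>"
  by (simp add: bd_def sum.subset_diff)

lemma bd_bd:
  assumes "cell_complex C" "\<sigma> \<in> C (j - 1)"
  shows "bd (C j) (bd (C (j + 1)) w) \<sigma> = 0"
proof -
  have "bd (C j) (bd (C (j + 1)) w) \<sigma> = (\<Sum>\<tau>\<in>C j. \<Sum>\<upsilon>\<in>C (j + 1). bdry \<sigma> \<tau> * (bdry \<tau> \<upsilon> * w \<upsilon>))"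
    by (simp add: bd_def sum_distrib_left)
  also have "\<dots> = (\<Sum>\<upsilon>\<in>C (j + 1). bd (C j) (\<lambda>\<tau>. bdry \<tau> \<upsilon>) \<sigma> * w \<upsilon>)"
    by (subst sum.swap) (simp add: bd_def sum_distrib_right mult.assoc)
  also have "\<dots> = 0" using assms unfolding cell_complex_def by (intro sum.neutral) simp
  finally show ?thesis .
qed

lemma cell_homology_eq: "cell_homology C j = cycle_group C j Mod boundaries C j"
proof -
  have "kernel (int_vectors (C j)) (int_vectors (C (j - 1))) (submatrix_map bdry (C (j - 1)) (C j))
      = {z \<in> C j \<rightarrow>\<^sub>E UNIV. \<forall>\<sigma>\<in>C (j - 1). bd (C j) z \<sigma> = 0}"
    by (auto simp: kernel_def submatrix_map_def bd_def restrict_def fun_eq_iff)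
  moreover have "submatrix_map bdry (C j) (C (j + 1)) ` carrier (int_vectors (C (j + 1))) = boundaries C j"
  proof (intro equalityI subsetI)
    fix z assume "z \<in> submatrix_map bdry (C j) (C (j + 1)) ` carrier (int_vectors (C (j + 1)))"
    then obtain w where "z = submatrix_map bdry (C j) (C (j + 1)) w" by blast
    then show "z \<in> boundaries C j"
      by (auto simp: boundaries_def submatrix_map_def bd_def)
  next
    fix z assume "z \<in> boundaries C j"
    then obtain w where w: "z \<in> C j \<rightarrow>\<^sub>E UNIV" "\<forall>\<sigma>\<in>C j. bd (C (j + 1)) w \<sigma> = z \<sigma>"
      by (auto simp: boundaries_def)
    have "z = submatrix_map bdry (C j) (C (j + 1)) (restrict w (C (j + 1)))"
    proof (rule ext)
      fix \<sigma>
      show "z \<sigma> = submatrix_map bdry (C j) (C (j + 1)) (restrict w (C (j + 1))) \<sigma>"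
        using w by (cases "\<sigma> \<in> C j") (auto simp: submatrix_map_def bd_def PiE_def extensional_def)
    qed
    then show "z \<in> submatrix_map bdry (C j) (C (j + 1)) ` carrier (int_vectors (C (j + 1)))" by simp
  qed
  ultimately show ?thesis by (simp add: cell_homology_def cycle_group_def)
qed

lemma carrier_cycle_group:
  "z \<in> carrier (cycle_group C j) \<longleftrightarrow> z \<in> C j \<rightarrow>\<^sub>E UNIV \<and> (\<forall>\<sigma>\<in>C (j - 1). bd (C j) z \<sigma> = 0)"
  by (simp add: cycle_group_def)

lemma restrict_in_cycle_group:
  "restrict z (C j) \<in> carrier (cycle_group C j) \<longleftrightarrow> (\<forall>\<sigma>\<in>C (j - 1). bd (C j) z \<sigma> = 0)"
  by (simp add: carrier_cycle_group)

lemma cycle_group_simps: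
  "x \<otimes>\<^bsub>cycle_group C j\<^esub> y = (\<lambda>\<tau>\<in>C j. x \<tau> + y \<tau>)" "\<one>\<^bsub>cycle_group C j\<^esub> = (\<lambda>\<tau>\<in>C j. 0)"
  by (simp_all add: cycle_group_def)

lemma inv_int_vectors: "x \<in> S \<rightarrow>\<^sub>E UNIV \<Longrightarrow> inv\<^bsub>int_vectors S\<^esub> x = (\<lambda>\<tau>\<in>S. - x \<tau>)"
  by (rule group.inv_equality) (auto intro: restrict_ext)

lemma bd_uminus: "bd S (\<lambda>\<tau>. - x \<tau>) \<sigma> = - bd S x \<sigma>"
  using bd_diff[of S "\<lambda>_. 0" x] by simp

lemma subgroup_cycles: "subgroup (carrier (cycle_group C j)) (int_vectors (C j))"
proof
  fix x assume "x \<in> carrier (cycle_group C j)"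
  then show "inv\<^bsub>int_vectors (C j)\<^esub> x \<in> carrier (cycle_group C j)"
    by (simp add: carrier_cycle_group inv_int_vectors bd_uminus)
qed (auto simp: carrier_cycle_group bd_add)

lemma comm_group_cycle_group: "comm_group (cycle_group C j)"
  using comm_group_subgroup[OF comm_group_int_vectors subgroup_cycles[of C j]]
  by (simp add: cycle_group_def)

lemma inv_cycle_group: "x \<in> carrier (cycle_group C j) \<Longrightarrow> inv\<^bsub>cycle_group C j\<^esub> x = (\<lambda>\<tau>\<in>C j. - x \<tau>)"
  using group.m_inv_consistent[OF group_int_vectors subgroup_cycles, of x C j]
  by (simp add: cycle_group_def inv_int_vectors)

lemma subgroup_boundaries:
  assumes "cell_complex C"
  shows "subgroup (boundaries C j) (cycle_group C j)"
proof
  show "boundaries C j \<subseteq> carrier (cycle_group C j)"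
  proof
    fix z assume "z \<in> boundaries C j"
    then obtain w where w: "z \<in> C j \<rightarrow>\<^sub>E UNIV" "\<forall>\<sigma>\<in>C j. bd (C (j + 1)) w \<sigma> = z \<sigma>"
      by (auto simp: boundaries_def)
    have "bd (C j) z \<sigma> = 0" if "\<sigma> \<in> C (j - 1)" for \<sigma>
      using bd_bd[OF assms that, of w] bd_cong[of "C j" z "bd (C (j + 1)) w" \<sigma>] w(2) by simp
    then show "z \<in> carrier (cycle_group C j)" using w(1) by (simp add: carrier_cycle_group)
  qed
  then show "inv\<^bsub>cycle_group C j\<^esub> x \<in> boundaries C j" if x: "x \<in> boundaries C j" for x
  proof -
    have inv: "inv\<^bsub>cycle_group C j\<^esub> x = (\<lambda>\<tau>\<in>C j. - x \<tau>)"
      using x \<open>boundaries C j \<subseteq> _\<close> inv_cycle_group by blast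
    obtain w where "\<forall>\<sigma>\<in>C j. bd (C (j + 1)) w \<sigma> = x \<sigma>" using x by (auto simp: boundaries_def)
    then have "\<forall>\<sigma>\<in>C j. bd (C (j + 1)) (\<lambda>\<tau>. - w \<tau>) \<sigma> = - x \<sigma>" by (simp add: bd_uminus)
    then show ?thesis unfolding inv boundaries_def by auto
  qed
  show "x \<otimes>\<^bsub>cycle_group C j\<^esub> y \<in> boundaries C j" if xy: "x \<in> boundaries C j" "y \<in> boundaries C j" for x y
  proof -
    obtain w w' where "\<forall>\<sigma>\<in>C j. bd (C (j + 1)) w \<sigma> = x \<sigma>" "\<forall>\<sigma>\<in>C j. bd (C (j + 1)) w' \<sigma> = y \<sigma>"
      using xy by (auto simp: boundaries_def)
    then have "\<forall>\<sigma>\<in>C j. bd (C (j + 1)) (\<lambda>\<tau>. w \<tau> + w' \<tau>) \<sigma> = x \<sigma> + y \<sigma>" by (simp add: bd_add)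
    then show ?thesis unfolding cycle_group_simps boundaries_def by auto
  qed
  show "\<one>\<^bsub>cycle_group C j\<^esub> \<in> boundaries C j"
    unfolding cycle_group_simps boundaries_def by (auto intro: exI[of _ "\<lambda>_. 0"])
qed

lemma comm_group_cell_homology: "cell_complex C \<Longrightarrow> comm_group (cell_homology C j)"
  unfolding cell_homology_eq
  by (intro comm_group.abelian_FactGroup comm_group_cycle_group subgroup_boundaries)

text \<open>The finitely many coordinates are integer-valued homomorphisms that separate
  cycles.\<close>

lemma fin_gen_cycle_group:
  assumes "finite (C j)"
  shows "fin_gen (cycle_group C j)"
proof -
  obtain e where e: "bij_betw e {..<card (C j)} (C j)"
    using ex_bij_betw_nat_finite[OF assms] by (auto simp: atLeast0LessThan)
  have eC: "e i \<in> C j" if "i < card (C j)" for i using e that by (auto simp: bij_betw_def)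
  show ?thesis
  proof (rule separated_by_int_homs_imp_free[of _ "card (C j)" "\<lambda>i z. z (e i)", THEN conjunct1])
    show "(\<lambda>z. z (e i)) \<in> hom (cycle_group C j) integer_group" if "i < card (C j)" for i
      using eC[OF that] by (auto simp: hom_def cycle_group_simps)
    show "x = \<one>\<^bsub>cycle_group C j\<^esub>"
      if x: "x \<in> carrier (cycle_group C j)" and 0: "\<And>i. i < card (C j) \<Longrightarrow> x (e i) = 0" for x
    proof (rule ext)
      fix \<tau>
      show "x \<tau> = \<one>\<^bsub>cycle_group C j\<^esub> \<tau>"
      proof (cases "\<tau> \<in> C j")
        case True
        then obtain i where "i < card (C j)" "\<tau> = e i" using e by (auto simp: bij_betw_def)
        then show ?thesis using 0 True by (simp add: cycle_group_simps)
      next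
        case False
        then show ?thesis using x by (auto simp: cycle_group_simps carrier_cycle_group PiE_def extensional_def)
      qed
    qed
  qed (rule comm_group_cycle_group)
qed

lemma pow_cycle_group:
  "z \<in> carrier (cycle_group C j) \<Longrightarrow> z [^]\<^bsub>cycle_group C j\<^esub> (m::nat) = (\<lambda>\<tau>\<in>C j. int m * z \<tau>)"
  using pow_int_vectors[of z "C j" m]
    monoid.nat_pow_consistent[OF group.is_monoid[OF group_int_vectors],
      where x = z and n = m and H = "carrier (cycle_group C j)"]
  by (simp add: carrier_cycle_group) (simp add: cycle_group_def)

lemma torsion_Mod_eq_carrier_iff:
  assumes "comm_group G" "subgroup N G"
  shows "torsion (G Mod N) = carrier (G Mod N) \<longleftrightarrow> (\<forall>x\<in>carrier G. \<exists>m>0. x [^]\<^bsub>G\<^esub> (m::nat) \<in> N)"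
proof -
  interpret comm_group G by fact
  interpret N: normal N G using subgroup_imp_normal[OF assms(2)] .
  have *: "(N #>\<^bsub>G\<^esub> x) [^]\<^bsub>G Mod N\<^esub> m = \<one>\<^bsub>G Mod N\<^esub> \<longleftrightarrow> x [^]\<^bsub>G\<^esub> m \<in> N"
    if "x \<in> carrier G" for x and m :: nat
  proof -
    have "(N #>\<^bsub>G\<^esub> x) [^]\<^bsub>G Mod N\<^esub> m = N #>\<^bsub>G\<^esub> (x [^]\<^bsub>G\<^esub> m)"
      using N.FactGroup_pow that by blast
    then show ?thesis
      using coset_join2[OF _ assms(2), of "x [^]\<^bsub>G\<^esub> m"] rcos_self[OF _ assms(2), of "x [^]\<^bsub>G\<^esub> m"] that by auto
  qed
  have "torsion (G Mod N) = carrier (G Mod N) \<longleftrightarrow>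
      (\<forall>X\<in>carrier (G Mod N). \<exists>m>0. X [^]\<^bsub>G Mod N\<^esub> (m::nat) = \<one>\<^bsub>G Mod N\<^esub>)"
    unfolding torsion_def by blast
  also have "\<dots> \<longleftrightarrow> (\<forall>x\<in>carrier G. \<exists>m>0. (N #>\<^bsub>G\<^esub> x) [^]\<^bsub>G Mod N\<^esub> (m::nat) = \<one>\<^bsub>G Mod N\<^esub>)"
    unfolding carrier_FactGroup by blast
  finally show ?thesis using * by simp
qed

text \<open>Rank 0 means that every class is torsion, and powers of a class are multiples of a
  representing cycle. From here on Betti numbers are conditions on integer matrices.\<close>

lemma free_rank_cell_homology_eq_0_iff:
  assumes "cell_complex C"
  shows "free_rank (cell_homology C j) = 0 \<longleftrightarrow>
    (\<forall>z. (\<forall>\<sigma>\<in>C (j - 1). bd (C j) z \<sigma> = 0) \<longrightarrow>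
       (\<exists>m>0. \<exists>w. \<forall>\<sigma>\<in>C j. bd (C (j + 1)) w \<sigma> = m * z \<sigma>))" (is "_ \<longleftrightarrow> ?R")
proof -
  have sub: "subgroup (boundaries C j) (cycle_group C j)" by (rule subgroup_boundaries) fact
  have "finite (C j)" using assms by (simp add: cell_complex_def)
  then have "fin_gen (cell_homology C j)"
    unfolding cell_homology_eq
    using fin_gen_Mod comm_group.subgroup_imp_normal[OF comm_group_cycle_group sub] fin_gen_cycle_group by blast
  then have "free_rank (cell_homology C j) = 0 \<longleftrightarrow>
      (\<forall>z\<in>carrier (cycle_group C j). \<exists>m>0. z [^]\<^bsub>cycle_group C j\<^esub> (m::nat) \<in> boundaries C j)"
    using free_rank_eq_0_iff[OF comm_group_cell_homology[OF assms]]
      torsion_Mod_eq_carrier_iff[OF comm_group_cycle_group sub] by (simp add: cell_homology_eq)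
  also have "\<dots> \<longleftrightarrow> (\<forall>z\<in>carrier (cycle_group C j). \<exists>m>0. \<exists>w. \<forall>\<sigma>\<in>C j. bd (C (j + 1)) w \<sigma> = int m * z \<sigma>)"
    by (intro ball_cong refl) (simp add: pow_cycle_group boundaries_def)
  also have "\<dots> \<longleftrightarrow> ?R"
  proof
    assume L: "\<forall>z\<in>carrier (cycle_group C j). \<exists>m>0. \<exists>w. \<forall>\<sigma>\<in>C j. bd (C (j + 1)) w \<sigma> = int m * z \<sigma>"
    show ?R
    proof (intro allI impI)
      fix z assume "\<forall>\<sigma>\<in>C (j - 1). bd (C j) z \<sigma> = 0"
      then have "restrict z (C j) \<in> carrier (cycle_group C j)" by (simp add: restrict_in_cycle_group)
      then obtain m w where mw: "m > 0" "\<forall>\<sigma>\<in>C j. bd (C (j + 1)) w \<sigma> = int m * restrict z (C j) \<sigma>"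
        using L by blast
      then have "int m > 0 \<and> (\<forall>\<sigma>\<in>C j. bd (C (j + 1)) w \<sigma> = int m * z \<sigma>)" by simp
      then show "\<exists>m>0. \<exists>w. \<forall>\<sigma>\<in>C j. bd (C (j + 1)) w \<sigma> = m * z \<sigma>" by blast
    qed
  next
    assume R: ?R
    show "\<forall>z\<in>carrier (cycle_group C j). \<exists>m>0. \<exists>w. \<forall>\<sigma>\<in>C j. bd (C (j + 1)) w \<sigma> = int m * z \<sigma>"
    proof
      fix z assume "z \<in> carrier (cycle_group C j)"
      then obtain m w where mw: "m > 0" "\<forall>\<sigma>\<in>C j. bd (C (j + 1)) w \<sigma> = m * z \<sigma>"
        using R by (auto simp: carrier_cycle_group)
      then have "nat m > 0 \<and> (\<forall>\<sigma>\<in>C j. bd (C (j + 1)) w \<sigma> = int (nat m) * z \<sigma>)" by simp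
      then show "\<exists>m>0. \<exists>w. \<forall>\<sigma>\<in>C j. bd (C (j + 1)) w \<sigma> = int m * z \<sigma>" by blast
    qed
  qed
  finally show ?thesis .
qed

section \<open>Quotient of a chain complex by an acyclic subcomplex\<close>

context
  fixes C D E :: "int \<Rightarrow> nat set set"
  assumes C: "cell_complex C"
    and D: "\<And>j. D j \<subseteq> C j"
    and E: "\<And>j. E j = C j - D j"
    and DE: "\<forall>j. \<forall>\<sigma>\<in>D (j - 1). \<forall>\<tau>\<in>E j. bdry \<sigma> \<tau> = 0"
    and acyclic: "\<forall>j z. (\<forall>\<sigma>\<in>E (j - 1). bd (E j) z \<sigma> = 0) \<longrightarrow>
                    (\<exists>w. \<forall>\<sigma>\<in>E j. bd (E (j + 1)) w \<sigma> = z \<sigma>)"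
begin

lemma bd_C: "bd (C j) z \<sigma> = bd (D j) z \<sigma> + bd (E j) z \<sigma>"
  using C D bd_Un unfolding E by (simp add: cell_complex_def)

lemma bd_E: "\<sigma> \<in> D (j - 1) \<Longrightarrow> bd (E j) z \<sigma> = 0"
  using DE by (simp add: bd_def)

text \<open>Faces in \<open>E\<close> have no boundary in \<open>D\<close>, so \<open>E\<close> is a
  subcomplex and restricting chains to \<open>D\<close> is the quotient chain map.\<close>

lemma bd_CD: "\<sigma> \<in> D (j - 1) \<Longrightarrow> bd (C j) z \<sigma> = bd (D j) z \<sigma>"
  using bd_C bd_E by simp

lemma bd_ext_D: "bd (C j) (\<lambda>\<tau>. if \<tau> \<in> D j then x \<tau> else 0) \<sigma> = bd (D j) x \<sigma>"
  using C D by (intro bd_subset) (auto simp: cell_complex_def)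

lemma bd_ext_E: "bd (C j) (\<lambda>\<tau>. if \<tau> \<in> E j then x \<tau> else 0) \<sigma> = bd (E j) x \<sigma>"
  using C E by (intro bd_subset) (auto simp: cell_complex_def)

lemma cell_complex_D: "cell_complex D"
  unfolding cell_complex_def
proof (intro conjI allI ballI)
  show "finite (D j)" for j using C finite_subset[OF D] by (simp add: cell_complex_def)
  fix j \<sigma> \<upsilon> assume *: "\<sigma> \<in> D (j - 1)" "\<upsilon> \<in> D (j + 1)"
  then have "bd (C j) (\<lambda>\<tau>. bdry \<tau> \<upsilon>) \<sigma> = 0"
    using C D by (auto simp: cell_complex_def subset_iff)
  then show "bd (D j) (\<lambda>\<tau>. bdry \<tau> \<upsilon>) \<sigma> = 0" using bd_CD *(1) by simp
qed

text \<open>A cycle of \<open>C\<close> that vanishes on \<open>D\<close> is a cycle of the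
  subcomplex \<open>E\<close>, where acyclicity fills it.\<close>

lemma E_cycle:
  assumes "\<And>\<sigma>. \<sigma> \<in> D j \<Longrightarrow> y \<sigma> = 0" "\<And>\<sigma>. \<sigma> \<in> C (j - 1) \<Longrightarrow> bd (C j) y \<sigma> = 0"
  shows "\<exists>w. \<forall>\<sigma>\<in>E j. bd (E (j + 1)) w \<sigma> = y \<sigma>"
proof (rule acyclic[rule_format])
  fix \<sigma> assume "\<sigma> \<in> E (j - 1)"
  then have "bd (C j) y \<sigma> = 0" using assms(2) E by blast
  moreover have "bd (D j) y \<sigma> = 0" using assms(1) by (simp add: bd_def)
  ultimately show "bd (E j) y \<sigma> = 0" using bd_C[of j y \<sigma>] by simp
qed

text \<open>Surjectivity on homology. Extended by zero, \<open>c\<close> has a boundary supported on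
  \<open>E\<close>; subtracting a filling of it repairs the extension without changing it on
  \<open>D\<close>.\<close>

lemma lift_relative_cycle:
  assumes c: "\<And>\<sigma>. \<sigma> \<in> D (j - 1) \<Longrightarrow> bd (D j) c \<sigma> = 0"
  shows "\<exists>z. (\<forall>\<sigma>\<in>C (j - 1). bd (C j) z \<sigma> = 0) \<and> (\<forall>\<tau>\<in>D j. z \<tau> = c \<tau>)"
proof -
  \<comment> \<open>Here \<open>bd\<close> is read in all rows of \<open>C (j - 1)\<close>, not only
    those of \<open>D (j - 1)\<close>: this is the boundary in \<open>C\<close> of \<open>c\<close>
    extended by zero.\<close>
  define y where "y = bd (D j) c"
  have "\<exists>w. \<forall>\<sigma>\<in>E (j - 1). bd (E (j - 1 + 1)) w \<sigma> = y \<sigma>"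
  proof (rule E_cycle)
    show "y \<sigma> = 0" if "\<sigma> \<in> D (j - 1)" for \<sigma> using c that by (simp add: y_def)
    show "bd (C (j - 1)) y \<sigma> = 0" if "\<sigma> \<in> C (j - 1 - 1)" for \<sigma>
    proof -
      have "bd (C j) (\<lambda>\<tau>. if \<tau> \<in> D j then c \<tau> else 0) = y"
        unfolding y_def using bd_ext_D by blast
      then show ?thesis
        using bd_bd[OF C that, of "\<lambda>\<tau>. if \<tau> \<in> D j then c \<tau> else 0"] by simp
    qed
  qed
  then obtain w where w: "\<And>\<sigma>. \<sigma> \<in> E (j - 1) \<Longrightarrow> bd (E j) w \<sigma> = y \<sigma>" by auto
  define z where "z \<tau> = (if \<tau> \<in> D j then c \<tau> else 0) - (if \<tau> \<in> E j then w \<tau> else 0)" for \<tau>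
  have "bd (C j) z \<sigma> = 0" if "\<sigma> \<in> C (j - 1)" for \<sigma>
  proof -
    have "bd (C j) z \<sigma> = y \<sigma> - bd (E j) w \<sigma>"
      unfolding z_def bd_diff bd_ext_D bd_ext_E y_def ..
    then show ?thesis
      using w bd_E c that E by (cases "\<sigma> \<in> D (j - 1)") (auto simp: y_def)
  qed
  moreover have "z \<tau> = c \<tau>" if "\<tau> \<in> D j" for \<tau> using that E by (simp add: z_def)
  ultimately show ?thesis by blast
qed

text \<open>Injectivity on homology. Subtracting from \<open>z\<close> the boundary of
  \<open>d\<close> extended by zero leaves a cycle that vanishes on \<open>D\<close>, which can be
  filled inside \<open>E\<close>.\<close>

lemma lift_relative_boundary:
  assumes z: "\<And>\<sigma>. \<sigma> \<in> C (j - 1) \<Longrightarrow> bd (C j) z \<sigma> = 0"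
    and d: "\<And>\<sigma>. \<sigma> \<in> D j \<Longrightarrow> bd (D (j + 1)) d \<sigma> = z \<sigma>"
  shows "\<exists>u. \<forall>\<sigma>\<in>C j. bd (C (j + 1)) u \<sigma> = z \<sigma>"
proof -
  let ?d = "\<lambda>\<tau>. if \<tau> \<in> D (j + 1) then d \<tau> else 0"
  define y where "y \<sigma> = z \<sigma> - bd (C (j + 1)) ?d \<sigma>" for \<sigma>
  have "\<exists>w. \<forall>\<sigma>\<in>E j. bd (E (j + 1)) w \<sigma> = y \<sigma>"
  proof (rule E_cycle)
    show "y \<sigma> = 0" if "\<sigma> \<in> D j" for \<sigma> using d[OF that] by (simp add: y_def bd_ext_D)
    show "bd (C j) y \<sigma> = 0" if "\<sigma> \<in> C (j - 1)" for \<sigma>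
      unfolding y_def bd_diff using z[OF that] bd_bd[OF C that, of ?d] by simp
  qed
  then obtain w where w: "\<And>\<sigma>. \<sigma> \<in> E j \<Longrightarrow> bd (E (j + 1)) w \<sigma> = y \<sigma>" by auto
  define u where "u \<tau> = ?d \<tau> + (if \<tau> \<in> E (j + 1) then w \<tau> else 0)" for \<tau>
  have "bd (C (j + 1)) u \<sigma> = z \<sigma>" if "\<sigma> \<in> C j" for \<sigma>
  proof -
    have eq: "bd (C (j + 1)) u \<sigma> = bd (C (j + 1)) ?d \<sigma> + bd (E (j + 1)) w \<sigma>"
      unfolding u_def bd_add bd_ext_E ..
    show ?thesis
    proof (cases "\<sigma> \<in> D j")
      case True
      then show ?thesis using eq d bd_E[of \<sigma> "j + 1" w] by (simp add: bd_ext_D)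
    next
      case False
      then show ?thesis using eq w[of \<sigma>] that E by (simp add: y_def)
    qed
  qed
  then show ?thesis by blast
qed

text \<open>First isomorphism theorem for restriction followed by passing to classes: the two
  lifting lemmas give surjectivity and identify the kernel with the boundaries of
  \<open>C\<close>.\<close>

lemma cell_homology_restrict_iso: "cell_homology C j \<cong> cell_homology D j"
proof -
  interpret C: comm_group "cycle_group C j" by (rule comm_group_cycle_group)
  interpret D: comm_group "cycle_group D j" by (rule comm_group_cycle_group)
  have subD: "subgroup (boundaries D j) (cycle_group D j)"
    by (rule subgroup_boundaries[OF cell_complex_D])
  interpret N: normal "boundaries D j" "cycle_group D j" by (rule D.subgroup_imp_normal[OF subD])
  let ?r = "\<lambda>z. restrict z (D j)"
  have rcyc: "?r z \<in> carrier (cycle_group D j)" if "z \<in> carrier (cycle_group C j)" for z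
    unfolding restrict_in_cycle_group
  proof
    fix \<sigma> assume \<sigma>: "\<sigma> \<in> D (j - 1)"
    then have "bd (C j) z \<sigma> = 0" using that D[of "j - 1"] by (auto simp: carrier_cycle_group)
    then show "bd (D j) z \<sigma> = 0" using bd_CD[OF \<sigma>] by simp
  qed
  have rhom: "?r \<in> hom (cycle_group C j) (cycle_group D j)"
    using rcyc D[of j] by (intro homI) (auto simp: cycle_group_simps restrict_def fun_eq_iff)
  let ?h = "\<lambda>z. boundaries D j #>\<^bsub>cycle_group D j\<^esub> ?r z"
  have hhom: "?h \<in> hom (cycle_group C j) (cell_homology D j)"
    using hom_compose[OF rhom N.r_coset_hom_Mod] by (simp add: comp_def cell_homology_eq)
  interpret h: group_hom "cycle_group C j" "cell_homology D j" ?h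
    using hhom comm_group_cell_homology[OF cell_complex_D]
    by (simp add: group_hom_def group_hom_axioms_def C.is_group comm_group.axioms)
  have "?h ` carrier (cycle_group C j) = carrier (cell_homology D j)"
  proof
    show "carrier (cell_homology D j) \<subseteq> ?h ` carrier (cycle_group C j)"
    proof
      fix X assume "X \<in> carrier (cell_homology D j)"
      then obtain c where c: "c \<in> carrier (cycle_group D j)" "X = boundaries D j #>\<^bsub>cycle_group D j\<^esub> c"
        by (auto simp: cell_homology_eq carrier_FactGroup)
      then obtain z where z: "\<forall>\<sigma>\<in>C (j - 1). bd (C j) z \<sigma> = 0" "\<forall>\<tau>\<in>D j. z \<tau> = c \<tau>"
        using lift_relative_cycle[of j c] by (auto simp: carrier_cycle_group)
      have "?r (restrict z (C j)) = c"
      proof (rule ext)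
        show "?r (restrict z (C j)) \<tau> = c \<tau>" for \<tau>
          using z(2) c(1) D[of j] by (auto simp: restrict_def carrier_cycle_group PiE_def extensional_def)
      qed
      moreover have "restrict z (C j) \<in> carrier (cycle_group C j)"
        using z(1) by (simp add: restrict_in_cycle_group)
      ultimately show "X \<in> ?h ` carrier (cycle_group C j)" using c(2) by (metis (no_types, lifting) image_eqI)
    qed
  qed (use h.hom_closed in blast)
  moreover have "kernel (cycle_group C j) (cell_homology D j) ?h = boundaries C j"
  proof -
    have 1: "?h z = \<one>\<^bsub>cell_homology D j\<^esub> \<longleftrightarrow> ?r z \<in> boundaries D j" if "z \<in> carrier (cycle_group C j)" for z
      using D.coset_join2[OF _ subD, of "?r z"] D.rcos_self[OF _ subD, of "?r z"] rcyc[OF that]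
      by (auto simp: cell_homology_eq)
    have 2: "?r z \<in> boundaries D j \<longleftrightarrow> z \<in> boundaries C j" if z: "z \<in> carrier (cycle_group C j)" for z
    proof
      assume "?r z \<in> boundaries D j"
      then obtain d where "\<forall>\<sigma>\<in>D j. bd (D (j + 1)) d \<sigma> = z \<sigma>" by (auto simp: boundaries_def)
      then show "z \<in> boundaries C j"
        using lift_relative_boundary[of j z d] z by (auto simp: boundaries_def carrier_cycle_group)
    next
      assume "z \<in> boundaries C j"
      then obtain w where "\<forall>\<sigma>\<in>C j. bd (C (j + 1)) w \<sigma> = z \<sigma>" by (auto simp: boundaries_def)
      then have "\<forall>\<sigma>\<in>D j. bd (D (j + 1)) w \<sigma> = z \<sigma>" using bd_CD[of _ "j + 1" w] D[of j] by (metis add_diff_cancel_right' subsetD)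
      then show "?r z \<in> boundaries D j" by (auto simp: boundaries_def)
    qed
    have "boundaries C j \<subseteq> carrier (cycle_group C j)"
      using subgroup_boundaries[OF C] subgroup.subset by blast
    then show ?thesis unfolding kernel_def using 1 2 by blast
  qed
  ultimately show ?thesis using h.FactGroup_iso by (simp add: cell_homology_eq)
qed

end

section \<open>Cones\<close>

lemma faces_iff: "\<sigma> \<in> faces X j \<longleftrightarrow> \<sigma> \<in> X \<and> finite \<sigma> \<and> int (card \<sigma>) = j + 1"
  by (simp add: faces_def)

lemma finite_faces: "finite X \<Longrightarrow> finite (faces X j)"
  by (simp add: faces_def)

lemma faces_facet:
  assumes "\<And>\<sigma>. \<sigma> \<subseteq> \<tau> \<Longrightarrow> \<sigma> \<in> X" "\<tau> \<in> faces X j" "x \<in> \<tau>"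
  shows "\<tau> - {x} \<in> faces X (j - 1)"
proof -
  have f: "finite \<tau>" "int (card \<tau>) = j + 1" using assms(2) by (auto simp: faces_iff)
  have "card \<tau> > 0" using assms(3) f(1) by (auto simp: card_gt_0_iff)
  then have "int (card (\<tau> - {x})) = j - 1 + 1" using f assms(3) by (simp add: of_nat_diff)
  then show ?thesis using assms(1) f(1) by (auto simp: faces_iff)
qed

lemma cell_complex_faces:
  assumes "finite X" "\<And>\<sigma> \<tau>. \<tau> \<in> X \<Longrightarrow> \<sigma> \<subseteq> \<tau> \<Longrightarrow> \<sigma> \<in> X"
  shows "cell_complex (faces X)"
  unfolding cell_complex_def bd_def
proof (intro conjI allI ballI)
  show "finite (faces X j)" for j using finite_faces assms(1) .
  fix j \<sigma> \<upsilon> assume "\<sigma> \<in> faces X (j - 1)" and \<upsilon>: "\<upsilon> \<in> faces X (j + 1)"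
  have "\<upsilon> \<in> X" using \<upsilon> by (simp add: faces_iff)
  then have "\<upsilon> - {x} \<in> faces X j" if "x \<in> \<upsilon>" for x
    using faces_facet[OF assms(2)[OF \<open>\<upsilon> \<in> X\<close>] \<upsilon> that] by simp
  then show "(\<Sum>\<tau>\<in>faces X j. bdry \<sigma> \<tau> * bdry \<tau> \<upsilon>) = 0"
    using \<upsilon> assms(1) by (intro bdry_bdry finite_faces) (auto simp: faces_iff)
qed

text \<open>The faces of the cone by degree, split by whether they contain the apex; the shift in
  degree accounts for the extra vertex.\<close>

definition cone_faces :: "nat \<Rightarrow> nat set set \<Rightarrow> int \<Rightarrow> nat set set" where
  "cone_faces n R j = faces R j \<union> insert n ` faces R (j - 1)"

context
  fixes n :: nat and R :: "nat set set"
  assumes fin: "finite R" and below: "\<forall>\<tau>\<in>R. \<forall>x\<in>\<tau>. x < n"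
begin

lemma apex_notin: "\<tau> \<in> R \<Longrightarrow> n \<notin> \<tau>"
  using below by blast

lemma inj_on_insert_apex: "inj_on (insert n) (faces R j)"
  using apex_notin by (intro inj_onI) (metis faces_iff insert_ident)

lemma bd_cone_faces:
  "bd (cone_faces n R j) z \<sigma> =
     bd (faces R j) z \<sigma> + (\<Sum>\<rho>\<in>faces R (j - 1). bdry \<sigma> (insert n \<rho>) * z (insert n \<rho>))"
proof -
  have "faces R j \<inter> insert n ` faces R (j - 1) = {}"
    using apex_notin by (metis disjoint_iff faces_iff imageE insertI1)
  then show ?thesis
    unfolding bd_def cone_faces_def
    using finite_faces[OF fin] inj_on_insert_apex by (simp add: sum.union_disjoint sum.reindex)
qed

text \<open>The only face through the apex that has \<sigma> as a facet is
  \<open>insert n \<sigma>\<close>, and deleting its last vertex gives the sign.\<close>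

lemma bd_cone_faces_base:
  assumes "\<sigma> \<in> faces R (j - 1)"
  shows "bd (cone_faces n R j) z \<sigma> = bd (faces R j) z \<sigma> + (-1) ^ card \<sigma> * z (insert n \<sigma>)"
proof -
  have "(\<Sum>\<rho>\<in>faces R (j - 1). bdry \<sigma> (insert n \<rho>) * z (insert n \<rho>))
      = (\<Sum>\<rho>\<in>faces R (j - 1). if \<rho> = \<sigma> then (-1) ^ card \<sigma> * z (insert n \<sigma>) else 0)"
  proof (rule sum.cong)
    fix \<rho> assume "\<rho> \<in> faces R (j - 1)"
    then have "bdry \<sigma> (insert n \<rho>) = (if \<sigma> = \<rho> then (-1) ^ card \<rho> else 0)"
      using assms apex_notin below by (intro bdry_insert_apex(1)) (auto simp: faces_iff)
    then show "bdry \<sigma> (insert n \<rho>) * z (insert n \<rho>) = (if \<rho> = \<sigma> then (-1) ^ card \<sigma> * z (insert n \<sigma>) else 0)"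
      by simp
  qed simp
  then show ?thesis using bd_cone_faces finite_faces[OF fin] assms by simp
qed

lemma bdry_insert_base: "\<tau> \<in> faces R j \<Longrightarrow> bdry (insert n \<sigma>) \<tau> = 0"
  using apex_notin by (intro bdry_0) (auto simp: faces_iff)

lemma bd_cone_faces_apex:
  assumes "n \<notin> \<sigma>"
  shows "bd (cone_faces n R j) z (insert n \<sigma>) = bd (faces R (j - 1)) (\<lambda>\<rho>. z (insert n \<rho>)) \<sigma>"
proof -
  have "bd (faces R j) z (insert n \<sigma>) = 0" by (simp add: bd_def bdry_insert_base)
  moreover have "(\<Sum>\<rho>\<in>faces R (j - 1). bdry (insert n \<sigma>) (insert n \<rho>) * z (insert n \<rho>))
      = bd (faces R (j - 1)) (\<lambda>\<rho>. z (insert n \<rho>)) \<sigma>"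
    unfolding bd_def using assms below by (intro sum.cong) (auto simp: faces_iff bdry_insert_apex(2))
  ultimately show ?thesis using bd_cone_faces by simp
qed

text \<open>The usual contraction: joining every base face of a cycle to the apex gives a filling.
  On base faces the two signs cancel; on faces through the apex the cycle condition in the row of
  the opposite facet is used.\<close>

lemma cone_faces_acyclic:
  assumes "\<And>\<sigma>. \<sigma> \<in> cone_faces n R (j - 1) \<Longrightarrow> bd (cone_faces n R j) z \<sigma> = 0"
  shows "\<exists>w. \<forall>\<sigma>\<in>cone_faces n R j. bd (cone_faces n R (j + 1)) w \<sigma> = z \<sigma>"
proof -
  \<comment> \<open>The sign cancels the coefficient of \<open>insert n \<sigma>\<close> in
    \<open>bd_cone_faces_base\<close>; on base faces \<open>w\<close> is 0.\<close>
  define w where "w \<tau> = (if n \<in> \<tau> then (-1) ^ card (\<tau> - {n}) * z (\<tau> - {n}) else 0)" for \<tau>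
  have w: "w (insert n \<tau>) = (-1) ^ card \<tau> * z \<tau>" if "\<tau> \<in> R" for \<tau>
    using apex_notin[OF that] by (simp add: w_def)
  have w0: "w \<tau> = 0" if "\<tau> \<in> R" for \<tau>
    using apex_notin[OF that] by (simp add: w_def)
  have "bd (cone_faces n R (j + 1)) w \<sigma> = z \<sigma>" if "\<sigma> \<in> cone_faces n R j" for \<sigma>
    using that unfolding cone_faces_def[of n R j]
  proof
    assume \<sigma>: "\<sigma> \<in> faces R j"
    have "bd (faces R (j + 1)) w \<sigma> = 0"
      using w0 by (simp add: bd_def faces_iff)
    moreover have "(-1) ^ card \<sigma> * w (insert n \<sigma>) = z \<sigma>"
      using w[of \<sigma>] \<sigma> by (simp add: faces_iff mult.assoc[symmetric] power_add[symmetric] mult_2[symmetric])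
    ultimately show ?thesis using bd_cone_faces_base[of \<sigma> "j + 1" w] \<sigma> by simp
  next
    assume "\<sigma> \<in> insert n ` faces R (j - 1)"
    then obtain \<rho> where \<rho>: "\<sigma> = insert n \<rho>" "\<rho> \<in> faces R (j - 1)" by blast
    have s: "(-1::int) ^ card \<tau> = - ((-1) ^ card \<rho>)" if "\<tau> \<in> faces R j" for \<tau>
    proof -
      have "card \<tau> = Suc (card \<rho>)" using that \<rho> by (simp add: faces_iff)
      then show ?thesis by simp
    qed
    have "\<rho> \<in> cone_faces n R (j - 1)" using \<rho>(2) by (simp add: cone_faces_def)
    \<comment> \<open>In row \<rho> the cycle condition trades the base part of \<open>z\<close> for
      its value on \<open>insert n \<rho>\<close>.\<close>
    from assms[OF this] have cyc: "bd (faces R j) z \<rho> = - ((-1) ^ card \<rho> * z (insert n \<rho>))"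
      using bd_cone_faces_base[OF \<rho>(2), of z] by simp
    have "n \<notin> \<rho>" using \<rho>(2) apex_notin by (simp add: faces_iff)
    then have "bd (cone_faces n R (j + 1)) w \<sigma> = bd (faces R j) (\<lambda>\<tau>. w (insert n \<tau>)) \<rho>"
      using bd_cone_faces_apex[of \<rho> "j + 1" w] \<rho>(1) by simp
    also have "\<dots> = bd (faces R j) (\<lambda>\<tau>. - ((-1) ^ card \<rho>) * z \<tau>) \<rho>"
      using w s by (intro bd_cong) (simp add: faces_iff)
    also have "\<dots> = - ((-1) ^ card \<rho>) * bd (faces R j) z \<rho>"
      by (rule bd_mult)
    also have "\<dots> = z \<sigma>"
      unfolding cyc \<rho>(1) by (simp add: mult.assoc[symmetric] power_add[symmetric] mult_2[symmetric])
    finally show ?thesis .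
  qed
  then show ?thesis by blast
qed

text \<open>The columns of the faces through the apex form a basis of the column space. They are
  independent because in the rows of base faces they form a diagonal matrix with entries 1 or
  -1.\<close>

lemma submatrix_rank_cone_faces:
  assumes "\<forall>\<tau>\<in>R. \<forall>\<sigma>\<subseteq>\<tau>. \<sigma> \<in> R"
  shows "submatrix_rank bdry (cone_faces n R (j - 1)) (cone_faces n R j) = card (faces R (j - 1))"
proof -
  let ?A = "cone_faces n R (j - 1)" and ?B = "insert n ` faces R (j - 1)"
  have inj: "inj_matrix bdry ?A ?B"
    unfolding inj_matrix_def
  proof (intro allI impI ballI)
    fix c \<tau> assume c: "\<forall>\<sigma>\<in>?A. (\<Sum>\<tau>\<in>?B. bdry \<sigma> \<tau> * c \<tau>) = 0" and "\<tau> \<in> ?B"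
    then obtain \<sigma> where \<sigma>: "\<tau> = insert n \<sigma>" "\<sigma> \<in> faces R (j - 1)" by blast
    \<comment> \<open>Extending by 0 to base faces turns a sum over the faces through the apex into
      a boundary in the whole cone.\<close>
    let ?c = "\<lambda>\<tau>. if n \<in> \<tau> then c \<tau> else 0"
    have "bd (faces R j) ?c \<sigma> = 0" using apex_notin by (simp add: bd_def faces_iff)
    moreover have "bd (cone_faces n R j) ?c \<sigma> = (\<Sum>\<tau>\<in>?B. bdry \<sigma> \<tau> * c \<tau>)"
      using calculation bd_cone_faces[of j ?c \<sigma>] inj_on_insert_apex by (simp add: sum.reindex)
    moreover have "\<sigma> \<in> ?A" using \<sigma>(2) by (simp add: cone_faces_def)
    ultimately have "(-1) ^ card \<sigma> * c (insert n \<sigma>) = 0"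
      using c bd_cone_faces_base[OF \<sigma>(2), of ?c] by simp
    then show "c \<tau> = 0" using \<sigma>(1) by simp
  qed
  have span: "column bdry ?A \<tau> \<in> rat_fun.span (column bdry ?A ` ?B)" if \<tau>: "\<tau> \<in> cone_faces n R j" for \<tau>
    using \<tau> unfolding cone_faces_def[of n R j]
  proof
    assume "\<tau> \<in> ?B"
    then show ?thesis by (intro rat_fun.span_base) simp
  next
    assume \<tau>R: "\<tau> \<in> faces R j"
    have n\<tau>: "n \<notin> \<tau>" and fin\<tau>: "finite \<tau>" "\<tau> \<in> R" using \<tau>R apex_notin by (auto simp: faces_iff)
    \<comment> \<open>\<open>\<partial>\<partial> = 0\<close> on the cone over \<open>\<tau>\<close> expresses the column of \<open>\<tau>\<close> by columns of faces through \<open>n\<close>.\<close>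
    have rel: "bdry \<sigma> \<tau> = (\<Sum>\<rho>\<in>faces R (j - 1). - ((-1) ^ card \<tau>) * bdry \<rho> \<tau> * bdry \<sigma> (insert n \<rho>))" for \<sigma>
    proof -
      have "(\<Sum>\<rho>\<in>cone_faces n R j. bdry \<sigma> \<rho> * bdry \<rho> (insert n \<tau>)) = 0"
      proof (rule bdry_bdry)
        show "finite (cone_faces n R j)" using finite_faces[OF fin] by (simp add: cone_faces_def)
        fix x assume x: "x \<in> insert n \<tau>" and no: "insert n \<tau> - {x} \<notin> cone_faces n R j"
        have "insert n \<tau> - {x} \<in> cone_faces n R j"
        proof (cases "x = n")
          case True
          then show ?thesis using n\<tau> \<tau>R by (simp add: cone_faces_def)
        next
          case False
          then have "insert n \<tau> - {x} = insert n (\<tau> - {x})" "x \<in> \<tau>" using x by auto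
          then show ?thesis using faces_facet[of \<tau> R, OF _ \<tau>R] assms fin\<tau>(2) by (simp add: cone_faces_def)
        qed
        with no show "bdry \<sigma> (insert n \<tau> - {x}) = 0" by blast
      qed (use fin\<tau> in simp)
      also have "(\<Sum>\<rho>\<in>cone_faces n R j. bdry \<sigma> \<rho> * bdry \<rho> (insert n \<tau>))
         = bdry \<sigma> \<tau> * (-1) ^ card \<tau> + (\<Sum>\<rho>\<in>faces R (j - 1). bdry \<sigma> (insert n \<rho>) * bdry \<rho> \<tau>)"
      proof -
        have "bd (faces R j) (\<lambda>\<rho>. bdry \<rho> (insert n \<tau>)) \<sigma> = (\<Sum>\<rho>\<in>faces R j. if \<rho> = \<tau> then bdry \<sigma> \<tau> * (-1) ^ card \<tau> else 0)"
          unfolding bd_def using fin\<tau> below apex_notin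
          by (intro sum.cong) (auto simp: faces_iff bdry_insert_apex(1))
        also have "\<dots> = bdry \<sigma> \<tau> * (-1) ^ card \<tau>" using \<tau>R finite_faces[OF fin] by simp
        finally have 1: "bd (faces R j) (\<lambda>\<rho>. bdry \<rho> (insert n \<tau>)) \<sigma> = bdry \<sigma> \<tau> * (-1) ^ card \<tau>" .
        have "(\<Sum>\<rho>\<in>faces R (j - 1). bdry \<sigma> (insert n \<rho>) * bdry (insert n \<rho>) (insert n \<tau>))
            = (\<Sum>\<rho>\<in>faces R (j - 1). bdry \<sigma> (insert n \<rho>) * bdry \<rho> \<tau>)"
          using fin\<tau> below apex_notin by (intro sum.cong) (auto simp: faces_iff bdry_insert_apex(2))
        then show ?thesis
          using bd_cone_faces[of j "\<lambda>\<rho>. bdry \<rho> (insert n \<tau>)" \<sigma>] 1 by (simp add: bd_def)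
      qed
      finally have eq: "bdry \<sigma> \<tau> * (-1) ^ card \<tau> = - (\<Sum>\<rho>\<in>faces R (j - 1). bdry \<sigma> (insert n \<rho>) * bdry \<rho> \<tau>)"
        by simp
      have "bdry \<sigma> \<tau> = (bdry \<sigma> \<tau> * (-1) ^ card \<tau>) * (-1) ^ card \<tau>"
        by (simp add: mult.assoc power_add[symmetric] mult_2[symmetric])
      also have "\<dots> = (\<Sum>\<rho>\<in>faces R (j - 1). - ((-1) ^ card \<tau>) * bdry \<rho> \<tau> * bdry \<sigma> (insert n \<rho>))"
        unfolding eq by (simp add: sum_distrib_left sum_negf mult_ac)
      finally show ?thesis .
    qed
    have "column bdry ?A \<tau> = (\<Sum>\<rho>\<in>faces R (j - 1).
        (\<lambda>\<sigma>. rat_of_int (- ((-1) ^ card \<tau>) * bdry \<rho> \<tau>) * column bdry ?A (insert n \<rho>) \<sigma>))"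
    proof (rule ext)
      fix \<sigma>
      show "column bdry ?A \<tau> \<sigma> = (\<Sum>\<rho>\<in>faces R (j - 1).
        (\<lambda>\<sigma>. rat_of_int (- ((-1) ^ card \<tau>) * bdry \<rho> \<tau>) * column bdry ?A (insert n \<rho>) \<sigma>)) \<sigma>"
        unfolding sum_fun_apply column_def
        by (subst rel) (simp del: of_int_mult of_int_minus add: of_int_mult[symmetric])
    qed
    also have "\<dots> \<in> rat_fun.span (column bdry ?A ` ?B)"
      by (intro rat_fun.span_sum rat_fun.span_scale rat_fun.span_base) auto
    finally show ?thesis .
  qed
  have "submatrix_rank bdry ?A (cone_faces n R j) = card ?B"
    using finite_faces[OF fin] by (intro submatrix_rank_eq_card inj span) (auto simp: cone_faces_def)
  then show ?thesis using inj_on_insert_apex by (simp add: card_image)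
qed

lemma faces_Cone: "faces (Cone n R) j = cone_faces n R j"
proof (intro equalityI subsetI)
  fix \<tau> assume \<tau>: "\<tau> \<in> faces (Cone n R) j"
  show "\<tau> \<in> cone_faces n R j"
  proof (cases "\<tau> \<in> R")
    case True
    then show ?thesis using \<tau> by (simp add: cone_faces_def faces_iff)
  next
    case False
    then obtain \<sigma> where \<sigma>: "\<sigma> \<in> R" "\<tau> = insert n \<sigma>" using \<tau> by (auto simp: Cone_def faces_iff)
    then have "\<sigma> \<in> faces R (j - 1)" using \<tau> apex_notin by (auto simp: faces_iff)
    then show ?thesis using \<sigma>(2) by (simp add: cone_faces_def)
  qed
next
  fix \<tau> assume "\<tau> \<in> cone_faces n R j"
  then show "\<tau> \<in> faces (Cone n R) j"
    using apex_notin by (auto simp: cone_faces_def faces_iff Cone_def)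
qed

end

section \<open>Homology of a complex with a cone attached\<close>

lemma faces_Un: "faces (X \<union> Y) j = faces X j \<union> faces Y j"
  by (auto simp: faces_def)

text \<open>The quotient argument with the cone over \<open>R\<close> as acyclic subcomplex; the
  faces of \<open>F\<close> outside \<open>R\<close> are what remains. The two
  \<open>cell_complex\<close> conclusions allow Betti numbers to be compared along the
  isomorphism.\<close>

theorem reduced_homology_Un_Cone_iso:
  assumes "finite F" "R \<subseteq> F"
    and below: "\<forall>\<tau>\<in>F. \<forall>x\<in>\<tau>. x < n"
    and F: "\<forall>\<tau>\<in>F. \<forall>\<sigma>\<subseteq>\<tau>. \<sigma> \<in> F"
    and R: "\<forall>\<tau>\<in>R. \<forall>\<sigma>\<subseteq>\<tau>. \<sigma> \<in> R"
  shows "reduced_homology (F \<union> Cone n R) j \<cong> relative_homology F R j"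
    and "cell_complex (faces (F \<union> Cone n R))"
    and "cell_complex (\<lambda>j. faces F j - faces R j)"
proof -
  let ?C = "faces (F \<union> Cone n R)" and ?D = "\<lambda>j. faces F j - faces R j" and ?E = "cone_faces n R"
  have fR: "finite R" and bR: "\<forall>\<tau>\<in>R. \<forall>x\<in>\<tau>. x < n"
    using assms(1-3) by (auto intro: finite_subset)
  note cone = faces_Cone[OF fR bR] and nR = apex_notin[OF fR bR]
  have nF: "n \<notin> \<tau>" if "\<tau> \<in> F" for \<tau> using below that by blast
  have C: "?C j = faces F j \<union> ?E j" for j by (simp add: faces_Un cone)
  show cc: "cell_complex ?C"
  proof (rule cell_complex_faces)
    have "Cone n R = R \<union> insert n ` R" by (auto simp: Cone_def)
    then show "finite (F \<union> Cone n R)" using assms(1) fR by simp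
    fix \<sigma> \<tau> assume \<tau>: "\<tau> \<in> F \<union> Cone n R" "\<sigma> \<subseteq> \<tau>"
    show "\<sigma> \<in> F \<union> Cone n R"
    proof (cases "\<tau> \<in> F")
      case True
      then show ?thesis using F \<tau>(2) by blast
    next
      case False
      then obtain \<rho> where \<rho>: "\<rho> \<in> R" "\<tau> = insert n \<rho>" using \<tau>(1) assms(2) by (auto simp: Cone_def)
      then have "\<sigma> - {n} \<in> R" using R \<tau>(2) by blast
      then have "\<sigma> - {n} \<in> Cone n R" "(\<sigma> - {n}) \<union> {n} \<in> Cone n R"
        unfolding Cone_def by blast+
      moreover have "\<sigma> = \<sigma> - {n} \<or> \<sigma> = (\<sigma> - {n}) \<union> {n}" by blast
      ultimately show ?thesis by (metis UnCI)
    qed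
  qed
  have D: "?D j \<subseteq> ?C j" for j by (auto simp: C)
  have E: "?E j = ?C j - ?D j" for j
  proof (intro equalityI subsetI)
    fix \<tau> assume \<tau>: "\<tau> \<in> ?E j"
    have "\<tau> \<notin> ?D j"
    proof
      assume "\<tau> \<in> ?D j"
      with \<tau> have "\<tau> \<in> F" "n \<in> \<tau>" by (auto simp: cone_faces_def faces_iff)
      then show False using nF by blast
    qed
    then show "\<tau> \<in> ?C j - ?D j" using \<tau> C by blast
  next
    fix \<tau> assume "\<tau> \<in> ?C j - ?D j"
    then show "\<tau> \<in> ?E j" using C[of j] by (auto simp: cone_faces_def)
  qed
  \<comment> \<open>A facet of a cone face either contains the apex or lies in \<open>R\<close>, so
    it is never a face of \<open>F\<close> outside \<open>R\<close>.\<close>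
  have DE: "bdry \<sigma> \<tau> = 0" if \<sigma>\<tau>: "\<sigma> \<in> ?D (j - 1)" "\<tau> \<in> ?E j" for j \<sigma> \<tau>
  proof (rule bdry_0)
    show "finite \<tau>" using \<sigma>\<tau>(2) by (auto simp: cone_faces_def faces_iff)
    fix x assume x: "x \<in> \<tau>"
    have \<sigma>: "\<sigma> \<in> F" "\<sigma> \<notin> R" using \<sigma>\<tau>(1) by (auto simp: faces_iff)
    show "\<sigma> \<noteq> \<tau> - {x}"
    proof
      assume eq: "\<sigma> = \<tau> - {x}"
      show False
      proof (cases "\<tau> \<in> R")
        case True
        then show ?thesis using R \<sigma>(2) eq by blast
      next
        case False
        then obtain \<rho> where \<rho>: "\<rho> \<in> R" "\<tau> = insert n \<rho>"
          using \<sigma>\<tau>(2) by (auto simp: cone_faces_def faces_iff)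
        then show ?thesis using eq \<sigma> nF[OF \<sigma>(1)] nR[OF \<rho>(1)] by (cases "x = n") auto
      qed
    qed
  qed
  have DE': "\<forall>j. \<forall>\<sigma>\<in>?D (j - 1). \<forall>\<tau>\<in>?E j. bdry \<sigma> \<tau> = 0" using DE by blast
  have acyclic: "\<forall>j z. (\<forall>\<sigma>\<in>?E (j - 1). bd (?E j) z \<sigma> = 0) \<longrightarrow>
      (\<exists>w. \<forall>\<sigma>\<in>?E j. bd (?E (j + 1)) w \<sigma> = z \<sigma>)"
    using cone_faces_acyclic[OF fR bR] by blast
  note hyps = cc D E DE' acyclic
  show "reduced_homology (F \<union> Cone n R) j \<cong> relative_homology F R j"
    unfolding reduced_homology_def relative_homology_def
    by (rule cell_homology_restrict_iso[OF hyps])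
  show "cell_complex ?D" by (rule cell_complex_D[OF hyps])
qed

section \<open>Spanning trees and rooted forests\<close>

lemma simplicial_complex_onD:
  assumes "simplicial_complex_on m \<Delta>"
  shows "finite \<Delta>" "\<tau> \<in> \<Delta> \<Longrightarrow> \<tau> \<subseteq> {1..m}" "\<tau> \<in> \<Delta> \<Longrightarrow> finite \<tau>" "\<tau> \<in> \<Delta> \<Longrightarrow> \<sigma> \<subseteq> \<tau> \<Longrightarrow> \<sigma> \<in> \<Delta>"
proof -
  show *: "\<tau> \<in> \<Delta> \<Longrightarrow> \<tau> \<subseteq> {1..m}" for \<tau> using assms by (auto simp: simplicial_complex_on_def)
  have "\<Delta> \<subseteq> Pow {1..m}" using assms by (simp add: simplicial_complex_on_def)
  then show "finite \<Delta>" by (rule finite_subset) simp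
  show "\<tau> \<in> \<Delta> \<Longrightarrow> finite \<tau>" using * finite_subset by blast
  show "\<tau> \<in> \<Delta> \<Longrightarrow> \<sigma> \<subseteq> \<tau> \<Longrightarrow> \<sigma> \<in> \<Delta>" using assms by (auto simp: simplicial_complex_on_def)
qed

lemma complexes_between_iff:
  assumes "simplicial_complex_on m \<Delta>"
  shows "X \<in> complexes_between m k \<Delta> \<longleftrightarrow>
    (\<forall>\<sigma>\<in>\<Delta>. int (card \<sigma>) \<le> k \<longrightarrow> \<sigma> \<in> X) \<and> X \<subseteq> \<Delta> \<and> (\<forall>\<sigma>\<in>X. int (card \<sigma>) \<le> k + 1)"
proof -
  have "skel m j \<inter> \<Delta> = {\<sigma> \<in> \<Delta>. int (card \<sigma>) \<le> j + 1}" for j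
    using simplicial_complex_onD(2)[OF assms] by (auto simp: skel_def)
  then show ?thesis by (auto simp: complexes_between_def)
qed

text \<open>A proper subset has at most \<open>k\<close> elements, and at those sizes
  \<open>X\<close> contains everything in \<Delta>.\<close>

lemma complexes_between_closed:
  assumes "simplicial_complex_on m \<Delta>" "X \<in> complexes_between m k \<Delta>" "\<tau> \<in> X" "\<sigma> \<subseteq> \<tau>"
  shows "\<sigma> \<in> X"
proof (cases "\<sigma> = \<tau>")
  case False
  have X: "\<tau> \<in> \<Delta>" "int (card \<tau>) \<le> k + 1" "\<And>\<sigma>. \<sigma> \<in> \<Delta> \<Longrightarrow> int (card \<sigma>) \<le> k \<Longrightarrow> \<sigma> \<in> X"
    using assms(2,3) unfolding complexes_between_iff[OF assms(1)] by auto
  have "card \<sigma> < card \<tau>"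
    using False assms(4) simplicial_complex_onD(3)[OF assms(1) X(1)] by (intro psubset_card_mono) auto
  then show ?thesis using X simplicial_complex_onD(4)[OF assms(1) X(1) assms(4)] by auto
qed (use assms in simp)

lemma simplicial_complex_on_Cone:
  assumes "simplicial_complex_on (n - 1) \<Delta>" "n \<ge> 1"
  shows "simplicial_complex_on n (Cone n \<Delta>)"
  unfolding simplicial_complex_on_def
proof (intro conjI ballI allI impI)
  note \<Delta> = simplicial_complex_onD[OF assms(1)]
  show "Cone n \<Delta> \<noteq> {}" using assms(1) by (auto simp: Cone_def simplicial_complex_on_def)
  show "Cone n \<Delta> \<subseteq> Pow {1..n}" using \<Delta>(2) assms(2) by (fastforce simp: Cone_def)
  fix \<tau> \<sigma> assume \<tau>: "\<tau> \<in> Cone n \<Delta>" "\<sigma> \<subseteq> \<tau>"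
  then obtain \<rho> where \<rho>: "\<rho> \<in> \<Delta>" "\<tau> = \<rho> \<or> \<tau> = \<rho> \<union> {n}" by (auto simp: Cone_def)
  then have "\<sigma> - {n} \<in> \<Delta>" using \<Delta>(4)[of \<rho> "\<sigma> - {n}"] \<tau>(2) by blast
  then have "\<sigma> - {n} \<in> Cone n \<Delta>" "(\<sigma> - {n}) \<union> {n} \<in> Cone n \<Delta>"
    unfolding Cone_def by blast+
  moreover have "\<sigma> = \<sigma> - {n} \<or> \<sigma> = (\<sigma> - {n}) \<union> {n}" by blast
  ultimately show "\<sigma> \<in> Cone n \<Delta>" by metis
qed

section \<open>Trees of the cone and rooted forests of the base\<close>

context
  fixes n :: nat and k :: int and \<Delta> :: "nat set set"
  assumes n: "n \<ge> 1" and \<Delta>: "simplicial_complex_on (n - 1) \<Delta>"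
begin

lemma Cone_complex: "simplicial_complex_on n (Cone n \<Delta>)"
  using simplicial_complex_on_Cone[OF \<Delta> n] .

lemma below_apex: "\<tau> \<in> \<Delta> \<Longrightarrow> x \<in> \<tau> \<Longrightarrow> x < n"
  using simplicial_complex_onD(2)[OF \<Delta>] n by fastforce

lemma apex_notin_face: "\<tau> \<in> \<Delta> \<Longrightarrow> n \<notin> \<tau>"
  using below_apex by blast

lemma card_insert_apex: "\<tau> \<in> \<Delta> \<Longrightarrow> card (insert n \<tau>) = Suc (card \<tau>)"
  using apex_notin_face simplicial_complex_onD(3)[OF \<Delta>] by simp

text \<open>The apex adds one vertex, which is why level \<open>k - 1\<close> for \<open>R\<close>
  fits level \<open>k\<close> for the union. Both parts can be read off again because no face of
  \<Delta> contains \<open>n\<close>.\<close>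

lemma Un_Cone_complexes_between:
  assumes "F \<in> complexes_between (n - 1) k \<Delta>" "R \<in> complexes_between (n - 1) (k - 1) \<Delta>"
  shows "F \<union> Cone n R \<in> complexes_between n k (Cone n \<Delta>)"
    and "Proj \<Delta> (F \<union> Cone n R) = F" and "Link n \<Delta> (F \<union> Cone n R) = R" and "R \<subseteq> F"
proof -
  have F: "\<And>\<sigma>. \<sigma> \<in> \<Delta> \<Longrightarrow> int (card \<sigma>) \<le> k \<Longrightarrow> \<sigma> \<in> F" "F \<subseteq> \<Delta>" "\<And>\<sigma>. \<sigma> \<in> F \<Longrightarrow> int (card \<sigma>) \<le> k + 1"
    using assms(1) unfolding complexes_between_iff[OF \<Delta>] by auto
  have R: "\<And>\<sigma>. \<sigma> \<in> \<Delta> \<Longrightarrow> int (card \<sigma>) \<le> k - 1 \<Longrightarrow> \<sigma> \<in> R" "R \<subseteq> \<Delta>" "\<And>\<sigma>. \<sigma> \<in> R \<Longrightarrow> int (card \<sigma>) \<le> k"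
    using assms(2) unfolding complexes_between_iff[OF \<Delta>] by auto
  \<comment> \<open>Faces of \<open>R\<close> have at most \<open>k\<close> vertices, and
    \<open>F\<close> contains all such faces of \<Delta>.\<close>
  show RF: "R \<subseteq> F" using F(1) R(2,3) by blast
  have Cone: "Cone n X = X \<union> insert n ` X" for X by (auto simp: Cone_def)
  show "F \<union> Cone n R \<in> complexes_between n k (Cone n \<Delta>)"
    unfolding complexes_between_iff[OF Cone_complex]
  proof (intro conjI ballI impI)
    fix \<sigma> assume \<sigma>: "\<sigma> \<in> Cone n \<Delta>" "int (card \<sigma>) \<le> k"
    then consider "\<sigma> \<in> \<Delta>" | \<rho> where "\<rho> \<in> \<Delta>" "\<sigma> = insert n \<rho>" unfolding Cone by blast
    then show "\<sigma> \<in> F \<union> Cone n R"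
    proof cases
      case 1
      then show ?thesis using F(1) \<sigma>(2) by blast
    next
      case 2
      then have "\<rho> \<in> R" using R(1)[of \<rho>] card_insert_apex[of \<rho>] \<sigma>(2) by simp
      then show ?thesis using 2 by (simp add: Cone)
    qed
  next
    show "F \<union> Cone n R \<subseteq> Cone n \<Delta>" using F(2) R(2) unfolding Cone by blast
    fix \<sigma> assume "\<sigma> \<in> F \<union> Cone n R"
    then consider "\<sigma> \<in> F" | \<rho> where "\<rho> \<in> R" "\<sigma> = insert n \<rho>" unfolding Cone using RF by blast
    then show "int (card \<sigma>) \<le> k + 1"
      using F(3) R(2,3) card_insert_apex by cases auto
  qed
  show "Proj \<Delta> (F \<union> Cone n R) = F"
    using F(2) RF apex_notin_face unfolding Proj_def Cone by blast
  have "\<sigma> \<in> R" if \<sigma>: "\<sigma> \<in> \<Delta>" "insert n \<sigma> \<in> F \<union> Cone n R" for \<sigma>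
  proof -
    have "insert n \<sigma> \<notin> \<Delta>" using apex_notin_face by blast
    then obtain \<rho> where "\<rho> \<in> R" "insert n \<sigma> = insert n \<rho>" using \<sigma>(2) F(2) R(2) unfolding Cone by blast
    then show ?thesis using apex_notin_face[OF \<sigma>(1)] apex_notin_face[of \<rho>] R(2) by (metis insert_ident subsetD)
  qed
  then show "Link n \<Delta> (F \<union> Cone n R) = R"
    using R(2) unfolding Link_def by (auto simp: Cone)
qed

lemma Proj_Link_complexes_between:
  assumes X: "X \<in> complexes_between n k (Cone n \<Delta>)"
  shows "Proj \<Delta> X \<in> complexes_between (n - 1) k \<Delta>" and "Link n \<Delta> X \<in> complexes_between (n - 1) (k - 1) \<Delta>"
    and "Proj \<Delta> X \<union> Cone n (Link n \<Delta> X) = X"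
proof -
  have Cone: "Cone n X = X \<union> insert n ` X" for X by (auto simp: Cone_def)
  have X': "\<And>\<sigma>. \<sigma> \<in> Cone n \<Delta> \<Longrightarrow> int (card \<sigma>) \<le> k \<Longrightarrow> \<sigma> \<in> X" "X \<subseteq> Cone n \<Delta>" "\<And>\<sigma>. \<sigma> \<in> X \<Longrightarrow> int (card \<sigma>) \<le> k + 1"
    using X unfolding complexes_between_iff[OF Cone_complex] by auto
  show "Proj \<Delta> X \<in> complexes_between (n - 1) k \<Delta>"
    unfolding complexes_between_iff[OF \<Delta>] Proj_def using X'(1,3) by (auto simp: Cone)
  show "Link n \<Delta> X \<in> complexes_between (n - 1) (k - 1) \<Delta>"
    unfolding complexes_between_iff[OF \<Delta>] Link_def
  proof (intro conjI ballI impI)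
    show "\<sigma> \<in> {\<sigma> \<in> \<Delta>. \<sigma> \<union> {n} \<in> X}" if "\<sigma> \<in> \<Delta>" "int (card \<sigma>) \<le> k - 1" for \<sigma>
      using that X'(1)[of "insert n \<sigma>"] card_insert_apex[of \<sigma>] by (simp add: Cone)
    show "int (card \<sigma>) \<le> k - 1 + 1" if "\<sigma> \<in> {\<sigma> \<in> \<Delta>. \<sigma> \<union> {n} \<in> X}" for \<sigma>
      using that X'(3)[of "insert n \<sigma>"] card_insert_apex[of \<sigma>] by simp
  qed auto
  \<comment> \<open>The cone over the link contains the link itself, so reassembling must not add
    these faces to \<open>X\<close>.\<close>
  have sub: "Link n \<Delta> X \<subseteq> X"
    using complexes_between_closed[OF Cone_complex X] unfolding Link_def by blast
  show "Proj \<Delta> X \<union> Cone n (Link n \<Delta> X) = X"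
    using X'(2) sub unfolding Proj_def Cone by (auto simp: Link_def)
qed

lemma spanning_tree_iff_rooted_forest:
  assumes F: "F \<in> complexes_between (n - 1) k \<Delta>" and R: "R \<in> complexes_between (n - 1) (k - 1) \<Delta>"
  shows "reduced_homology (F \<union> Cone n R) j \<cong> relative_homology F R j"
    and "F \<union> Cone n R \<in> spanning_trees n k (Cone n \<Delta>) \<longleftrightarrow> (F, R) \<in> rooted_forests (n - 1) k \<Delta>"
proof -
  note TC = Un_Cone_complexes_between[OF F R]
  have F': "\<And>\<sigma>. \<sigma> \<in> \<Delta> \<Longrightarrow> int (card \<sigma>) \<le> k \<Longrightarrow> \<sigma> \<in> F" "F \<subseteq> \<Delta>" "\<And>\<sigma>. \<sigma> \<in> F \<Longrightarrow> int (card \<sigma>) \<le> k + 1"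
    using F unfolding complexes_between_iff[OF \<Delta>] by auto
  have R': "\<And>\<sigma>. \<sigma> \<in> \<Delta> \<Longrightarrow> int (card \<sigma>) \<le> k - 1 \<Longrightarrow> \<sigma> \<in> R" "R \<subseteq> \<Delta>" "\<And>\<sigma>. \<sigma> \<in> R \<Longrightarrow> int (card \<sigma>) \<le> k"
    using R unfolding complexes_between_iff[OF \<Delta>] by auto
  have fin: "finite F" "finite R" "finite \<Delta>"
    using simplicial_complex_onD(1)[OF \<Delta>] F'(2) R'(2) finite_subset by blast+
  have below: "\<forall>\<tau>\<in>F. \<forall>x\<in>\<tau>. x < n" "\<forall>\<tau>\<in>R. \<forall>x\<in>\<tau>. x < n" "\<forall>\<tau>\<in>\<Delta>. \<forall>x\<in>\<tau>. x < n"
    using F'(2) R'(2) below_apex by blast+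
  have closed: "\<forall>\<tau>\<in>F. \<forall>\<sigma>\<subseteq>\<tau>. \<sigma> \<in> F" "\<forall>\<tau>\<in>R. \<forall>\<sigma>\<subseteq>\<tau>. \<sigma> \<in> R" "\<forall>\<tau>\<in>\<Delta>. \<forall>\<sigma>\<subseteq>\<tau>. \<sigma> \<in> \<Delta>"
    using complexes_between_closed[OF \<Delta> F] complexes_between_closed[OF \<Delta> R] simplicial_complex_onD(4)[OF \<Delta>]
    by blast+
  note iso = reduced_homology_Un_Cone_iso[OF fin(1) TC(4) below(1) closed(1,2)]
  show "reduced_homology (F \<union> Cone n R) j \<cong> relative_homology F R j" by (rule iso(1))
  let ?T = "F \<union> Cone n R"
  define D where "D j = faces F j - faces R j" for j
  have D: "cell_complex D" unfolding D_def using iso(3) .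
  have "\<sigma> \<notin> faces R k" for \<sigma>
    using R'(3)[of \<sigma>] by (auto simp: faces_iff)
  then have Dk: "D k = faces F k" unfolding D_def by blast
  \<comment> \<open>In degree \<open>k - 2\<close> both \<open>F\<close> and \<open>R\<close>
    contain all faces of \<Delta>, so the relative faces vanish there; above degree \<open>k\<close>
    there are none in \<open>F\<close>.\<close>
  have "\<sigma> \<in> faces R (k - 2)" if "\<sigma> \<in> faces F (k - 2)" for \<sigma>
    using that R'(1)[of \<sigma>] F'(2) by (auto simp: faces_iff)
  moreover have "\<sigma> \<notin> faces F (k + 1)" for \<sigma>
    using F'(3)[of \<sigma>] by (auto simp: faces_iff)
  ultimately have D0: "D (k - 2) = {}" "D (k + 1) = {}"
    unfolding D_def by blast+
  have finD: "finite (D j)" for j using D by (simp add: cell_complex_def)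
  have F1: "faces F (k - 1) = faces \<Delta> (k - 1)"
    using F'(1,2) by (auto simp: faces_iff)
  have R1: "faces R (k - 1) \<subseteq> faces \<Delta> (k - 1)" using R'(2) by (auto simp: faces_iff)
  let ?S = "inj_matrix bdry (D (k - 1)) (D k)"
  let ?Q = "rat_surj_matrix bdry (D (k - 1)) (D k)"
  let ?P = "card (D k) = card (D (k - 1))"
  have rel: "relative_betti F R j = free_rank (cell_homology D j)" for j
    by (simp add: relative_betti_def relative_homology_def D_def[abs_def])
  \<comment> \<open>With no faces in degree \<open>k + 1\<close> the only boundary in degree
    \<open>k\<close> is 0, so a torsion cycle must vanish.\<close>
  have "relative_betti F R k = 0 \<longleftrightarrow>
      (\<forall>z. (\<forall>\<sigma>\<in>D (k - 1). bd (D k) z \<sigma> = 0) \<longrightarrow> (\<exists>m>0. \<forall>\<sigma>\<in>D k. 0 = (m::int) * z \<sigma>))"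
    unfolding rel free_rank_cell_homology_eq_0_iff[OF D] D0 by (simp add: bd_def)
  also have "\<dots> \<longleftrightarrow> ?S"
  proof -
    have "(\<exists>m>0. \<forall>\<sigma>\<in>D k. 0 = (m::int) * z \<sigma>) \<longleftrightarrow> (\<forall>\<sigma>\<in>D k. z \<sigma> = 0)" for z
      by (auto intro: exI[of _ 1])
    then show ?thesis by (simp add: inj_matrix_def bd_def)
  qed
  finally have S: "relative_betti F R k = 0 \<longleftrightarrow> ?S" .
  \<comment> \<open>With no faces in degree \<open>k - 2\<close> every chain in degree
    \<open>k - 1\<close> is a cycle.\<close>
  have Q: "relative_betti F R (k - 1) = 0 \<longleftrightarrow> ?Q"
    unfolding rel free_rank_cell_homology_eq_0_iff[OF D] rat_surj_matrix_def using D0(1) by (simp add: bd_def)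
  have forest: "(F, R) \<in> rooted_forests (n - 1) k \<Delta> \<longleftrightarrow> (?P \<and> ?Q) \<or> (?P \<and> ?S) \<or> (?Q \<and> ?S)"
    using F R S Q by (simp add: rooted_forests_def Let_def Dk D_def[of "k - 1"])
  have PQ: "?P \<Longrightarrow> ?Q \<Longrightarrow> ?S"
    using square_rat_surj_imp_inj_matrix[OF finD finD, of bdry "k - 1" k] by simp
  have QS: "?P" if ?Q ?S
  proof (rule antisym)
    show "card (D k) \<le> card (D (k - 1))" using inj_matrix_card_le[OF finD finD that(2)] .
    have "card (D (k - 1)) \<le> card (column bdry (D (k - 1)) ` D k)"
      using rat_surj_matrix_card_le[OF finD finD that(1) rat_fun.span_superset] finD by blast
    also have "\<dots> \<le> card (D k)" using finD by (rule card_image_le)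
    finally show "card (D (k - 1)) \<le> card (D k)" .
  qed
  have "betti ?T k = relative_betti F R k"
    unfolding betti_def relative_betti_def
  proof (rule free_rank_iso)
    show "comm_group (reduced_homology ?T k)"
      unfolding reduced_homology_def by (rule comm_group_cell_homology[OF iso(2)])
    show "comm_group (relative_homology F R k)"
      unfolding relative_homology_def by (rule comm_group_cell_homology[OF iso(3)])
  qed (rule iso(1))
  moreover have "submatrix_rank bdry (faces (Cone n \<Delta>) (k - 1)) (faces (Cone n \<Delta>) k) = card (faces \<Delta> (k - 1))"
    using submatrix_rank_cone_faces[OF fin(3) below(3) closed(3), of k]
    by (simp add: faces_Cone[OF fin(3) below(3)])
  moreover have "card (faces ?T k) = card (faces F k) + card (faces R (k - 1))"
  proof -
    have "faces ?T k = faces F k \<union> insert n ` faces R (k - 1)"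
      using TC(4) by (auto simp: faces_Un faces_Cone[OF fin(2) below(2)] cone_faces_def faces_iff)
    moreover have "faces F k \<inter> insert n ` faces R (k - 1) = {}"
    proof -
      have "n \<notin> \<tau>" if "\<tau> \<in> faces F k" for \<tau> using that below(1) by (auto simp: faces_iff)
      then show ?thesis by blast
    qed
    ultimately show ?thesis
      using finite_faces fin inj_on_insert_apex[OF fin(2) below(2)]
      by (simp add: card_Un_disjoint card_image)
  qed
  moreover have "card (D (k - 1)) + card (faces R (k - 1)) = card (faces \<Delta> (k - 1))"
    unfolding D_def F1 using card_Diff_subset[OF _ R1] card_mono[OF _ R1] finite_faces fin by simp
  \<comment> \<open>The count required of a tree is |F_k| + |R_{k-1}| = |\<Delta>_{k-1}|. Since
    \<open>F\<close> and \<Delta> have the same faces in degree \<open>k - 1\<close>, cancelling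
    |R_{k-1}| leaves \<open>?P\<close>.\<close>
  ultimately have "?T \<in> spanning_trees n k (Cone n \<Delta>) \<longleftrightarrow> ?S \<and> ?P"
    using TC(1) S Dk by (auto simp: spanning_trees_def)
  then show "?T \<in> spanning_trees n k (Cone n \<Delta>) \<longleftrightarrow> (F, R) \<in> rooted_forests (n - 1) k \<Delta>"
    unfolding forest using PQ QS by blast
qed

text \<open>\<open>F \<union> Cone n R\<close> inverts the map already between all complexes of the
  two kinds; the equivalence of trees and forests shows that both directions restrict.\<close>

lemma bij_betw_spanning_trees_rooted_forests:
  "bij_betw (\<lambda>X. (Proj \<Delta> X, Link n \<Delta> X)) (spanning_trees n k (Cone n \<Delta>)) (rooted_forests (n - 1) k \<Delta>)"
proof (rule bij_betw_byWitness[where f' = "\<lambda>(F, R). F \<union> Cone n R"])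
  have tree: "X \<in> complexes_between n k (Cone n \<Delta>)" if "X \<in> spanning_trees n k (Cone n \<Delta>)" for X
    using that by (simp add: spanning_trees_def)
  have forest: "F \<in> complexes_between (n - 1) k \<Delta>" "R \<in> complexes_between (n - 1) (k - 1) \<Delta>"
    if "(F, R) \<in> rooted_forests (n - 1) k \<Delta>" for F R
    using that by (auto simp: rooted_forests_def)
  show "\<forall>X\<in>spanning_trees n k (Cone n \<Delta>). (case (Proj \<Delta> X, Link n \<Delta> X) of (F, R) \<Rightarrow> F \<union> Cone n R) = X"
    using Proj_Link_complexes_between(3)[OF tree] by simp
  show "\<forall>p\<in>rooted_forests (n - 1) k \<Delta>.
      (Proj \<Delta> (case p of (F, R) \<Rightarrow> F \<union> Cone n R), Link n \<Delta> (case p of (F, R) \<Rightarrow> F \<union> Cone n R)) = p"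
    using Un_Cone_complexes_between(2,3)[OF forest] by auto
  show "(\<lambda>X. (Proj \<Delta> X, Link n \<Delta> X)) ` spanning_trees n k (Cone n \<Delta>) \<subseteq> rooted_forests (n - 1) k \<Delta>"
  proof (rule image_subsetI)
    fix X assume X: "X \<in> spanning_trees n k (Cone n \<Delta>)"
    note PL = Proj_Link_complexes_between[OF tree[OF X]]
    show "(Proj \<Delta> X, Link n \<Delta> X) \<in> rooted_forests (n - 1) k \<Delta>"
      using spanning_tree_iff_rooted_forest(2)[OF PL(1,2)] X PL(3) by simp
  qed
  show "(\<lambda>(F, R). F \<union> Cone n R) ` rooted_forests (n - 1) k \<Delta> \<subseteq> spanning_trees n k (Cone n \<Delta>)"
    using spanning_tree_iff_rooted_forest(2)[OF forest] by auto
qed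

end

theorem theorem2p12:
  fixes n :: nat and k :: int and \<Delta> :: "nat set set"
  assumes "n \<ge> 2"
    and "simplicial_complex_on (n - 1) \<Delta>"
  shows "(\<forall>F \<in> complexes_between (n - 1) k \<Delta>. \<forall>R \<in> complexes_between (n - 1) (k - 1) \<Delta>.
            let T = F \<union> Cone n R in
              (\<forall>j. reduced_homology T j \<cong> relative_homology F R j) \<and>
              (T \<in> spanning_trees n k (Cone n \<Delta>) \<longleftrightarrow> (F, R) \<in> rooted_forests (n - 1) k \<Delta>)) \<and>
         bij_betw (\<lambda>X. (Proj \<Delta> X, Link n \<Delta> X))
           (spanning_trees n k (Cone n \<Delta>)) (rooted_forests (n - 1) k \<Delta>)"
proof -
  have n: "n \<ge> 1" using assms(1) by simp
  show ?thesis
    unfolding Let_def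
    using spanning_tree_iff_rooted_forest[OF n assms(2)]
      bij_betw_spanning_trees_rooted_forests[OF n assms(2)] by blast
qed

end
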